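(* Let $(X,S_1,\ldots,S_k)$ be a minimal $\mathbb{Z}^k$-system and let $T_1,\ldots,T_d \in \langle S_1,\ldots,S_k\rangle$. Then the sequences $(T_1^n)_{n\in\mathbb{Z}},\ldots,(T_d^n)_{n\in\mathbb{Z}}$ are jointly transitive if and only if both of the following conditions are satisfied: (i) $(X,T_i^{-1}T_j)$ is transitive for all $1\leq i,j\leq d$ with $i\neq j$; and (ii) $(X^d,T_1\times\cdots\times T_d)$ is transitive.
   Context: A $\mathbb{Z}^k$-system $(X,S_1,\ldots,S_k)$ consists of a (nonempty) compact metric space $X$ and homeomorphisms $S_1,\ldots,S_k\colon X\to X$ with $S_iS_j=S_jS_i$ for all $i,j$; $\langle S_1,\ldots,S_k\rangle$ is the group of homeomorphisms they generate. The orbit of $x\in X$ is $\{S_1^{m_1}\cdots S_k^{m_k}x:(m_1,\ldots,m_k)\in\mathbb{Z}^k\}$. The system is minimal if every orbit is dense in $X$, and transitive if some point has a dense orbit. For a single homeomorphism $T$ of a compact metric space $Z$, $(Z,T)$ is regarded as a $\mathbb{Z}$-system, so it is transitive if $\{T^nz:n\in\mathbb{Z}\}$ is dense in $Z$ for some $z\in Z$. The map $T_1\times\cdots\times T_d$ acts on $X^d$ coordinatewise: $(x_1,\ldots,x_d)\mapsto(T_1x_1,\ldots,T_dx_d)$. The sequences $(T_1^n)_{n\in\mathbb{Z}},\ldots,(T_d^n)_{n\in\mathbb{Z}}$ are jointly transitive if there is a dense $G_\delta$ subset $X_0\subseteq X$ such that for all $x\in X_0$ the set $\{(T_1^nx,\ldots,T_d^nx):n\in\mathbb{Z}\}$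 is dense in $X^d$. *)

theory Defs
  imports "HOL-Analysis.Analysis" "HOL-Algebra.Bij" "HOL-Algebra.Generated_Groups"
begin

text \<open>
  Self-homeomorphisms of a space are represented as elements of the library group
  \<^const>\<open>BijGroup\<close> of its carrier, hence as functions that are \<^const>\<open>undefined\<close> off the
  carrier. Composition, inverses, integer powers and generated subgroups are those of that group.
\<close>

abbreviation bij_grp :: "'a topology \<Rightarrow> ('a \<Rightarrow> 'a) monoid"
  where "bij_grp X \<equiv> BijGroup (topspace X)"

definition self_homeos :: "'a topology \<Rightarrow> ('a \<Rightarrow> 'a) set"
  where "self_homeos X = {f \<in> Bij (topspace X). homeomorphic_map X X f}"

definition zk_system :: "'a metric \<Rightarrow> nat \<Rightarrow> (nat \<Rightarrow> 'a \<Rightarrow> 'a) \<Rightarrow> bool"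
  where "zk_system M k S \<longleftrightarrow>
    mspace M \<noteq> {} \<and> compact_space (mtopology_of M) \<and>
    (\<forall>i\<in>{1..k}. S i \<in> self_homeos (mtopology_of M)) \<and>
    (\<forall>i\<in>{1..k}. \<forall>j\<in>{1..k}. \<forall>x\<in>mspace M. S i (S j x) = S j (S i x))"

text \<open>The map $S_1^{m_1} \cdots S_k^{m_k}$.\<close>

primrec zk_action :: "'a topology \<Rightarrow> (nat \<Rightarrow> 'a \<Rightarrow> 'a) \<Rightarrow> (nat \<Rightarrow> int) \<Rightarrow> nat \<Rightarrow> 'a \<Rightarrow> 'a"
  where
    "zk_action X S m 0 = \<one>\<^bsub>bij_grp X\<^esub>"
  | "zk_action X S m (Suc k) =
       zk_action X S m k \<otimes>\<^bsub>bij_grp X\<^esub> (S (Suc k) [^]\<^bsub>bij_grp X\<^esub> m (Suc k))"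

definition zk_orbit :: "'a topology \<Rightarrow> nat \<Rightarrow> (nat \<Rightarrow> 'a \<Rightarrow> 'a) \<Rightarrow> 'a \<Rightarrow> 'a set"
  where "zk_orbit X k S x = {zk_action X S m k x | m. True}"

definition minimal_zk_system :: "'a metric \<Rightarrow> nat \<Rightarrow> (nat \<Rightarrow> 'a \<Rightarrow> 'a) \<Rightarrow> bool"
  where "minimal_zk_system M k S \<longleftrightarrow> zk_system M k S \<and>
    (\<forall>x\<in>mspace M. mtopology_of M closure_of zk_orbit (mtopology_of M) k S x = mspace M)"

definition transitive_homeo :: "'a topology \<Rightarrow> ('a \<Rightarrow> 'a) \<Rightarrow> bool"
  where "transitive_homeo X T \<longleftrightarrow>
    (\<exists>z\<in>topspace X. X closure_of {(T [^]\<^bsub>bij_grp X\<^esub> (n::int)) z | n. True} = topspace X)"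

text \<open>The power $X^d$, whose points are the functions on $\{1,\dots,d\}$ with values in $X$
  (extended by \<^const>\<open>undefined\<close>), with the product topology.\<close>

abbreviation power_space :: "'a topology \<Rightarrow> nat \<Rightarrow> (nat \<Rightarrow> 'a) topology"
  where "power_space X d \<equiv> product_topology (\<lambda>_. X) {1..d}"

definition prod_map :: "'a topology \<Rightarrow> nat \<Rightarrow> (nat \<Rightarrow> 'a \<Rightarrow> 'a) \<Rightarrow> (nat \<Rightarrow> 'a) \<Rightarrow> (nat \<Rightarrow> 'a)"
  where "prod_map X d T = (\<lambda>x\<in>topspace (power_space X d). \<lambda>i\<in>{1..d}. T i (x i))"

definition jointly_transitive :: "'a topology \<Rightarrow> nat \<Rightarrow> (nat \<Rightarrow> int \<Rightarrow> 'a \<Rightarrow> 'a) \<Rightarrow> bool"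
  where "jointly_transitive X d a \<longleftrightarrow>
    (\<exists>X0. gdelta_in X X0 \<and> X closure_of X0 = topspace X \<and>
      (\<forall>x\<in>X0. power_space X d closure_of {(\<lambda>i\<in>{1..d}. a i n x) | n. True}
               = topspace (power_space X d)))"

end

theory Submission
  imports Defs "HOL-Library.Function_Algebras"
begin

text \<open>
  Joint transitivity yields (i) and (ii) by looking at a generic point and at its diagonal point.
  For the converse, minimality upgrades ``some \<open>x\<close> and \<open>n\<close> satisfy \<open>T\<^sub>i\<^sup>n x \<in> V\<^sub>i\<close> for all \<open>i\<close>'' to
  ``some \<open>x\<close> in any prescribed open set does'', provided the product of the \<open>T\<^sub>i\<close> is transitive;
  the weaker property reduces to joint transitivity of the \<open>d - 1\<close> maps \<open>T\<^sub>i T\<^sub>1\<^sup>-\<^sup>1\<close>. The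
  induction needs the product of these quotients to be transitive, which is decided on
  equicontinuous factors, where it is inherited from the \<open>T\<^sub>i\<close> because \<open>(z\<^sub>i) \<mapsto> (z\<^sub>i - z\<^sub>1)\<close> is a
  homomorphism. Those factors enter as invariant continuous pseudometrics; an obstruction to
  product transitivity produces one by comparing the slices of a closed invariant relation
  with respect to an invariant mean (an idea of McMahon).
\<close>

section \<open>Minimal actions of abelian groups\<close>

text \<open>The obstacle is that the hypotheses do not pass to the quotients as they stand: (i)
  makes each quotient transitive on its own, and a product of transitive maps need not be
  transitive. So the induction in \<open>joint_visit\<close> carries \<open>bohr_dense\<close> in
  place of product transitivity. On the factor of an invariant pseudometric the distance from g x to
  h x does not depend on x, so the acting group behaves there like a dense subgroup of a compact
  abelian group K, and \<open>bohr_dense\<close> says that the tuples of the t_i n are dense in the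
  power of K. Product transitivity is recovered by refining the coordinates one at a time from the
  factor to X, and this refinement is where the mean enters. Being only finitely additive, the mean
  is replaced by its infimum over open supersets, the \<open>content\<close>. Strong subadditivity
  of the content gives the triangle inequality for slices, and its additivity on disjoint closed
  sets turns distance zero into null differences.\<close>

locale minimal_abelian_action =
  fixes X :: "'a topology" and act :: "'g::ab_group_add \<Rightarrow> 'a \<Rightarrow> 'a"
  assumes compact: "compact_space X" and Hausdorff: "Hausdorff_space X"
    and continuous_act: "continuous_map X X (act g)"
    and act_zero: "x \<in> topspace X \<Longrightarrow> act 0 x = x"
    and act_add: "x \<in> topspace X \<Longrightarrow> act (g + h) x = act g (act h x)"
    and dense_orbit: "x \<in> topspace X \<Longrightarrow> X closure_of (range (\<lambda>g. act g x)) = topspace X"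
begin

section \<open>Orbits and finite covers by translates\<close>

lemma act_closed: "x \<in> topspace X \<Longrightarrow> act g x \<in> topspace X"
  using continuous_act[of g] by (auto simp: continuous_map_def)

lemma act_minus: "x \<in> topspace X \<Longrightarrow> act (- g) (act g x) = x"
  by (metis act_add act_zero add.left_inverse)

lemma act_minus': "x \<in> topspace X \<Longrightarrow> act g (act (- g) x) = x"
  by (metis act_add act_zero add.right_inverse)

definition pre :: "'g \<Rightarrow> 'a set \<Rightarrow> 'a set"
  where "pre g U = {x \<in> topspace X. act g x \<in> U}"

lemma openin_pre: "openin X U \<Longrightarrow> openin X (pre g U)"
  unfolding pre_def by (rule openin_continuous_map_preimage[OF continuous_act])

lemma pre_subset: "pre g U \<subseteq> topspace X"
  by (auto simp: pre_def)

lemma orbit_meets_open: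
  assumes "openin X U" "U \<noteq> {}" "x \<in> topspace X"
  obtains g where "act g x \<in> U"
  using dense_orbit[OF assms(3)] assms(1,2) by (force simp: dense_intersects_open)

lemma finite_translates_cover:
  assumes "openin X U" "U \<noteq> {}"
  obtains F where "finite F" "\<And>x. x \<in> topspace X \<Longrightarrow> \<exists>g\<in>F. act g x \<in> U"
proof -
  have "topspace X \<subseteq> \<Union> (range (\<lambda>g. pre g U))"
  proof
    fix x assume x: "x \<in> topspace X"
    then obtain g where "act g x \<in> U" using orbit_meets_open[OF assms] by blast
    with x show "x \<in> \<Union> (range (\<lambda>g. pre g U))" by (auto simp: pre_def)
  qed
  moreover have "openin X W" if "W \<in> range (\<lambda>g. pre g U)" for W
    using openin_pre[OF assms(1)] that by blast
  ultimately obtain \<F> where F: "finite \<F>" "\<F> \<subseteq> range (\<lambda>g. pre g U)" "topspace X \<subseteq> \<Union>\<F>"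
    using compactinD[of X "topspace X" "range (\<lambda>g. pre g U)"] compact
    unfolding compact_space_def by blast
  obtain F where "finite F" "\<F> = (\<lambda>g. pre g U) ` F"
    using finite_subset_image[OF F(1,2)] by blast
  with F(3) show ?thesis
    by (intro that[of F]) (fastforce simp: pre_def)+
qed

text \<open>A factor of the action is encoded as a coarser topology on the same points, possibly not
  Hausdorff. One family of sets can then mix coordinates taken in X with coordinates taken in a
  factor.\<close>

definition invariant_coarsening :: "'a topology \<Rightarrow> bool"
  where "invariant_coarsening Y \<longleftrightarrow> topspace Y = topspace X \<and> (\<forall>U. openin Y U \<longrightarrow> openin X U) \<and>
    (\<forall>g. continuous_map Y Y (act g))"

lemma coarse_self: "invariant_coarsening X"
  using continuous_act by (simp add: invariant_coarsening_def)

lemma coarse_pre: "\<lbrakk>invariant_coarsening Y; openin Y U\<rbrakk> \<Longrightarrow> openin Y (pre g U)"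
  using openin_continuous_map_preimage[of Y Y "act g" U] unfolding pre_def invariant_coarsening_def by simp

text \<open>Transitivity of the product map tested on boxes, with a topology chosen per coordinate.
  The powers of a map are recorded as a homomorphism \<open>t i\<close> from the integers to the
  acting group, so that the quotient of two maps becomes the difference
  \<open>t i n - t j n\<close>.\<close>

definition prod_transitive :: "'i set \<Rightarrow> ('i \<Rightarrow> 'a topology) \<Rightarrow> ('i \<Rightarrow> int \<Rightarrow> 'g) \<Rightarrow> bool"
  where "prod_transitive I Y t \<longleftrightarrow>
    (\<forall>U V. (\<forall>i\<in>I. openin (Y i) (U i) \<and> U i \<noteq> {} \<and> openin (Y i) (V i) \<and> V i \<noteq> {}) \<longrightarrow>
      (\<exists>n. \<forall>i\<in>I. \<exists>u\<in>U i. act (t i n) u \<in> V i))"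

lemma prod_transitiveD:
  assumes "prod_transitive I Y t"
    and "\<And>i. i \<in> I \<Longrightarrow> openin (Y i) (U i)" "\<And>i. i \<in> I \<Longrightarrow> U i \<noteq> {}"
    and "\<And>i. i \<in> I \<Longrightarrow> openin (Y i) (V i)" "\<And>i. i \<in> I \<Longrightarrow> V i \<noteq> {}"
  shows "\<exists>n. \<forall>i\<in>I. \<exists>u\<in>U i. act (t i n) u \<in> V i"
  using assms unfolding prod_transitive_def by simp

definition transitive :: "(int \<Rightarrow> 'g) \<Rightarrow> bool"
  where "transitive t \<longleftrightarrow> (\<forall>U V. openin X U \<and> U \<noteq> {} \<and> openin X V \<and> V \<noteq> {} \<longrightarrow>
    (\<exists>n. \<exists>u\<in>U. act (t n) u \<in> V))"

lemma prod_transitive_imp_transitive: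
  assumes "prod_transitive I (\<lambda>_. X) t" "i \<in> I"
  shows "transitive (t i)"
  unfolding transitive_def
proof (intro allI impI)
  fix U V assume "openin X U \<and> U \<noteq> {} \<and> openin X V \<and> V \<noteq> {}"
  then show "\<exists>n. \<exists>u\<in>U. act (t i n) u \<in> V"
    using prod_transitiveD[OF assms(1), of "\<lambda>_. U" "\<lambda>_. V"] assms(2) by blast
qed

text \<open>Each tuple h in F asks for a time that, combined with the translations h_i, brings the
  small box back into U. The tuples are served one after the other: product transitivity sends a
  point of the current box into the preimage of U under h, and by continuity a smaller box follows
  it.\<close>

lemma prod_transitive_focus:
  fixes t :: "'i \<Rightarrow> int \<Rightarrow> 'g"
  assumes Y: "\<And>i. i \<in> I \<Longrightarrow> invariant_coarsening (Y i)" and trans: "prod_transitive I Y t"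
    and U: "\<And>i. i \<in> I \<Longrightarrow> openin (Y i) (U i)" "\<And>i. i \<in> I \<Longrightarrow> U i \<noteq> {}"
    and "finite F"
  shows "\<exists>U' m. \<forall>i\<in>I. openin (Y i) (U' i) \<and> U' i \<noteq> {} \<and> U' i \<subseteq> U i \<and>
      (\<forall>h\<in>F. \<forall>u\<in>U' i. act (t i (m h) + h i) u \<in> U i)"
    using \<open>finite F\<close>
  proof induction
    case empty
    then show ?case using U by (intro exI[of _ U]) auto
  next
    case (insert h F)
    then obtain U' m where IH: "\<And>i. i \<in> I \<Longrightarrow> openin (Y i) (U' i) \<and> U' i \<noteq> {} \<and> U' i \<subseteq> U i \<and>
      (\<forall>h\<in>F. \<forall>u\<in>U' i. act (t i (m h) + h i) u \<in> U i)" by metis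
    have sub: "U i \<subseteq> topspace X" if "i \<in> I" for i
      using U(1)[OF that] Y[OF that] openin_subset unfolding invariant_coarsening_def by blast
    have op: "openin (Y i) (pre (h i) (U i))" if "i \<in> I" for i
      using coarse_pre Y U that by blast
    have ne: "pre (h i) (U i) \<noteq> {}" if i: "i \<in> I" for i
    proof -
      obtain u where u: "u \<in> U i" using U(2)[OF i] by blast
      with sub[OF i] have "act (- h i) u \<in> pre (h i) (U i)"
        by (auto simp: pre_def act_closed act_minus')
      then show ?thesis by blast
    qed
    obtain n where n: "\<And>i. i \<in> I \<Longrightarrow> \<exists>u\<in>U' i. act (t i n) u \<in> pre (h i) (U i)"
      using prod_transitiveD[OF trans, of U' "\<lambda>i. pre (h i) (U i)"] IH op ne by blast
    have "\<forall>i\<in>I. openin (Y i) (U' i \<inter> pre (t i n + h i) (U i)) \<and>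
       U' i \<inter> pre (t i n + h i) (U i) \<noteq> {} \<and> U' i \<inter> pre (t i n + h i) (U i) \<subseteq> U i \<and>
      (\<forall>f\<in>insert h F. \<forall>u\<in>U' i \<inter> pre (t i n + h i) (U i). act (t i ((m(h := n)) f) + f i) u \<in> U i)"
    proof (intro ballI conjI)
      fix i assume i: "i \<in> I"
      show "openin (Y i) (U' i \<inter> pre (t i n + h i) (U i))"
        using IH[OF i] coarse_pre[OF Y[OF i] U(1)[OF i]] by blast
      obtain u where u: "u \<in> U' i" "act (t i n) u \<in> pre (h i) (U i)"
        using n[OF i] by blast
      then have "act (t i n + h i) u \<in> U i"
        using IH[OF i] sub[OF i] act_add[of u "h i" "t i n"] unfolding pre_def
        by (auto simp: add.commute)
      then show "U' i \<inter> pre (t i n + h i) (U i) \<noteq> {}"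
        using u IH[OF i] sub[OF i] by (auto simp: pre_def)
      show "U' i \<inter> pre (t i n + h i) (U i) \<subseteq> U i"
        using IH[OF i] by blast
      show "act (t i ((m(h := n)) f) + f i) u \<in> U i"
        if "f \<in> insert h F" "u \<in> U' i \<inter> pre (t i n + h i) (U i)" for f u
        using that IH[OF i] by (auto simp: pre_def)
    qed
    then show ?case
      by (intro exI[of _ "\<lambda>i. U' i \<inter> pre (t i n + h i) (U i)"] exI[of _ "m(h := n)"])
  qed

text \<open>Finitely many tuples h of translations suffice to carry any point into the box V. After
  focusing, time m(h) followed by h takes a point u of the small box into U; from there, time n -
  m(h) leads to the h-translate of u at time n, which is in V for a suitable h. So M consists of the
  m(h).\<close>

lemma syndetic_returns:
  fixes t :: "'i \<Rightarrow> int \<Rightarrow> 'g"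
  assumes "finite I" and Y: "\<And>i. i \<in> I \<Longrightarrow> invariant_coarsening (Y i)" and trans: "prod_transitive I Y t"
    and t: "\<And>i. i \<in> I \<Longrightarrow> Modules.additive (t i)"
    and U: "\<And>i. i \<in> I \<Longrightarrow> openin (Y i) (U i)" "\<And>i. i \<in> I \<Longrightarrow> U i \<noteq> {}"
    and V: "\<And>i. i \<in> I \<Longrightarrow> openin (Y i) (V i)" "\<And>i. i \<in> I \<Longrightarrow> V i \<noteq> {}"
  obtains M where "finite M" "\<And>n. \<exists>m\<in>M. \<forall>i\<in>I. \<exists>u\<in>U i. act (t i (n - m)) u \<in> V i"
proof -
  have "\<exists>F. finite F \<and> (\<forall>x\<in>topspace X. \<exists>g\<in>F. act g x \<in> V i)" if "i \<in> I" for i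
    using finite_translates_cover[of "V i"] V[OF that] Y[OF that] unfolding invariant_coarsening_def by metis
  then obtain F where F: "\<And>i. i \<in> I \<Longrightarrow> finite (F i)"
      "\<And>i x. \<lbrakk>i \<in> I; x \<in> topspace X\<rbrakk> \<Longrightarrow> \<exists>g\<in>F i. act g x \<in> V i"
    by metis
  have fin: "finite (Pi\<^sub>E I F)" using F(1) \<open>finite I\<close> by (simp add: finite_PiE)
  have "\<exists>U' m. \<forall>i\<in>I. openin (Y i) (U' i) \<and> U' i \<noteq> {} \<and> U' i \<subseteq> U i \<and>
      (\<forall>h\<in>Pi\<^sub>E I F. \<forall>u\<in>U' i. act (t i (m h) + h i) u \<in> U i)"
    by (intro prod_transitive_focus Y trans U fin)
  then obtain U' m where "\<forall>i\<in>I. openin (Y i) (U' i) \<and> U' i \<noteq> {} \<and> U' i \<subseteq> U i \<and>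
      (\<forall>h\<in>Pi\<^sub>E I F. \<forall>u\<in>U' i. act (t i (m h) + h i) u \<in> U i)"
    by (elim exE)
  then have U': "\<And>i. i \<in> I \<Longrightarrow> openin (Y i) (U' i)" "\<And>i. i \<in> I \<Longrightarrow> U' i \<noteq> {}"
    "\<And>h i u. \<lbrakk>h \<in> Pi\<^sub>E I F; i \<in> I; u \<in> U' i\<rbrakk> \<Longrightarrow> act (t i (m h) + h i) u \<in> U i"
    by auto
  have "\<exists>k\<in>m ` Pi\<^sub>E I F. \<forall>i\<in>I. \<exists>u\<in>U i. act (t i (n - k)) u \<in> V i" for n
  proof -
    have "\<forall>i\<in>I. \<exists>u. u \<in> U' i" using U'(2) by blast
    then obtain u where u: "\<And>i. i \<in> I \<Longrightarrow> u i \<in> U' i" by metis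
    have uX: "u i \<in> topspace X" if "i \<in> I" for i
      using u[OF that] U'(1)[OF that] Y[OF that] openin_subset unfolding invariant_coarsening_def by blast
    have "\<forall>i\<in>I. \<exists>g. g \<in> F i \<and> act g (act (t i n) (u i)) \<in> V i"
      using F(2) act_closed uX by blast
    then obtain h where h: "\<And>i. i \<in> I \<Longrightarrow> h i \<in> F i \<and> act (h i) (act (t i n) (u i)) \<in> V i"
      by metis
    \<comment> \<open>Focusing was applied to the finite set \<open>Pi\<^sub>E I F\<close>, whose
      members are extensional, so the chosen tuple is made extensional as well.\<close>
    define h' where "h' = restrict h I"
    have h': "h' \<in> Pi\<^sub>E I F" "\<And>i. i \<in> I \<Longrightarrow> h' i = h i"
      using h by (auto simp: h'_def)
    have "\<exists>w\<in>U i. act (t i (n - m h')) w \<in> V i" if i: "i \<in> I" for i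
    proof
      interpret Modules.additive "t i" by (rule t[OF i])
      show "act (t i (m h') + h i) (u i) \<in> U i"
        using U'(3)[OF h'(1) i u[OF i]] h'(2)[OF i] by simp
      have "act (t i (n - m h')) (act (t i (m h') + h i) (u i)) = act (t i n + h i) (u i)"
        by (simp add: act_add[symmetric] uX[OF i] diff)
      also have "\<dots> = act (h i) (act (t i n) (u i))"
        by (metis act_add add.commute uX[OF i])
      finally show "act (t i (n - m h')) (act (t i (m h') + h i) (u i)) \<in> V i"
        using h[OF i] by simp
    qed
    then show ?thesis using h'(1) by blast
  qed
  then show ?thesis using that fin by blast
qed

text \<open>Some member g of a finite set F moves the visiting point into W. Focusing V against F
  beforehand guarantees that whichever g occurs, its effect on the visits is repaired by the extra
  time m(g).\<close>

lemma joint_visit_from_open: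
  fixes t :: "'i \<Rightarrow> int \<Rightarrow> 'g"
  assumes trans: "prod_transitive I (\<lambda>_. X) t" and t: "\<And>i. i \<in> I \<Longrightarrow> Modules.additive (t i)"
    and visit: "\<And>V. (\<And>i. i \<in> I \<Longrightarrow> openin X (V i) \<and> V i \<noteq> {}) \<Longrightarrow>
      \<exists>x\<in>topspace X. \<exists>n. \<forall>i\<in>I. act (t i n) x \<in> V i"
    and W: "openin X W" "W \<noteq> {}" and V: "\<And>i. i \<in> I \<Longrightarrow> openin X (V i) \<and> V i \<noteq> {}"
  shows "\<exists>x\<in>W. \<exists>n. \<forall>i\<in>I. act (t i n) x \<in> V i"
proof -
  obtain F where F: "finite F" "\<And>x. x \<in> topspace X \<Longrightarrow> \<exists>g\<in>F. act g x \<in> W"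
    using finite_translates_cover[OF W] by blast
  have V0: "openin X (V i)" "V i \<noteq> {}" if "i \<in> I" for i using V that by auto
  \<comment> \<open>Constant tuples, because a single point is moved and every coordinate thereby
    undergoes the same g.\<close>
  have F': "finite ((\<lambda>g (_::'i). g) ` F)" using F(1) by simp
  have "\<exists>V' m. \<forall>i\<in>I. openin X (V' i) \<and> V' i \<noteq> {} \<and> V' i \<subseteq> V i \<and>
      (\<forall>h\<in>(\<lambda>g (_::'i). g) ` F. \<forall>u\<in>V' i. act (t i (m h) + h i) u \<in> V i)"
    by (intro prod_transitive_focus coarse_self trans V0 F')
  then obtain V' m where "\<forall>i\<in>I. openin X (V' i) \<and> V' i \<noteq> {} \<and> V' i \<subseteq> V i \<and>
      (\<forall>h\<in>(\<lambda>g (_::'i). g) ` F. \<forall>u\<in>V' i. act (t i (m h) + h i) u \<in> V i)"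
    by (elim exE)
  then have V': "\<And>i. i \<in> I \<Longrightarrow> openin X (V' i)" "\<And>i. i \<in> I \<Longrightarrow> V' i \<noteq> {}"
    "\<And>g i u. \<lbrakk>g \<in> F; i \<in> I; u \<in> V' i\<rbrakk> \<Longrightarrow> act (t i (m (\<lambda>_. g)) + g) u \<in> V i"
    by auto
  obtain x n where x: "x \<in> topspace X" "\<And>i. i \<in> I \<Longrightarrow> act (t i n) x \<in> V' i"
    using visit[of V'] V' by blast
  obtain g where g: "g \<in> F" "act g x \<in> W" using F(2) x(1) by blast
  have "act (t i (n + m (\<lambda>_. g))) (act g x) \<in> V i" if i: "i \<in> I" for i
  proof -
    interpret Modules.additive "t i" by (rule t[OF i])
    have "act (t i (n + m (\<lambda>_. g))) (act g x) = act (t i n + t i (m (\<lambda>_. g)) + g) x"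
      by (simp add: act_add[OF x(1)] add)
    also have "\<dots> = act (t i (m (\<lambda>_. g)) + g + t i n) x" by (simp add: ac_simps)
    also have "\<dots> = act (t i (m (\<lambda>_. g)) + g) (act (t i n) x)" by (rule act_add[OF x(1)])
    also have "\<dots> \<in> V i"
      using V'(3) x(2)[OF i] i g(1) by blast
    finally show ?thesis .
  qed
  then show ?thesis using g(2) by blast
qed

text \<open>The metric of an isometric factor pulled back to X; points at distance zero are the ones
  the factor identifies. The last clause gives joint continuity through symmetry and the triangle
  inequality.\<close>

definition invariant_pseudometric :: "('a \<Rightarrow> 'a \<Rightarrow> real) \<Rightarrow> bool"
  where "invariant_pseudometric \<rho> \<longleftrightarrow>
    (\<forall>x\<in>topspace X. \<rho> x x = 0) \<and>
    (\<forall>x\<in>topspace X. \<forall>y\<in>topspace X. \<rho> x y = \<rho> y x) \<and>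
    (\<forall>x\<in>topspace X. \<forall>y\<in>topspace X. \<forall>z\<in>topspace X. \<rho> x z \<le> \<rho> x y + \<rho> y z) \<and>
    (\<forall>x\<in>topspace X. \<forall>y\<in>topspace X. \<forall>g. \<rho> (act g x) (act g y) = \<rho> x y) \<and>
    (\<forall>x\<in>topspace X. \<forall>e>0. \<exists>U. openin X U \<and> x \<in> U \<and> (\<forall>y\<in>U. \<rho> x y < e))"

section \<open>Geometry of invariant pseudometrics\<close>

context
  fixes \<rho> assumes \<rho>: "invariant_pseudometric \<rho>"
begin

lemma pm_refl: "x \<in> topspace X \<Longrightarrow> \<rho> x x = 0"
  using \<rho> by (simp add: invariant_pseudometric_def)

lemma pm_sym: "\<lbrakk>x \<in> topspace X; y \<in> topspace X\<rbrakk> \<Longrightarrow> \<rho> x y = \<rho> y x"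
  using \<rho> by (simp add: invariant_pseudometric_def)

lemma pm_triangle:
  "\<lbrakk>x \<in> topspace X; y \<in> topspace X; z \<in> topspace X\<rbrakk> \<Longrightarrow> \<rho> x z \<le> \<rho> x y + \<rho> y z"
  using \<rho> by (simp add: invariant_pseudometric_def)

lemma pm_act: "\<lbrakk>x \<in> topspace X; y \<in> topspace X\<rbrakk> \<Longrightarrow> \<rho> (act g x) (act g y) = \<rho> x y"
  using \<rho> by (simp add: invariant_pseudometric_def)

lemma pm_nhd:
  assumes "x \<in> topspace X" "e > 0"
  obtains U where "openin X U" "x \<in> U" "\<And>y. y \<in> U \<Longrightarrow> \<rho> x y < e"
  using \<rho> assms unfolding invariant_pseudometric_def by metis

lemma pm_nonneg: "\<lbrakk>x \<in> topspace X; y \<in> topspace X\<rbrakk> \<Longrightarrow> 0 \<le> \<rho> x y"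
  using pm_triangle[of x y x] pm_sym[of x y] pm_refl[of x] by simp

lemma openin_pm_ball:
  assumes "a \<in> topspace X" shows "openin X {x \<in> topspace X. \<rho> a x < e}"
  unfolding openin_subopen[of X "{x \<in> topspace X. \<rho> a x < e}"]
proof
  fix x assume x: "x \<in> {x \<in> topspace X. \<rho> a x < e}"
  then obtain U where U: "openin X U" "x \<in> U" "\<And>y. y \<in> U \<Longrightarrow> \<rho> x y < e - \<rho> a x"
    using pm_nhd[of x "e - \<rho> a x"] by auto
  moreover have "\<rho> a y < e" if "y \<in> U" for y
    using U(3)[OF that] pm_triangle[of a x y] x assms that openin_subset[OF U(1)] by force
  ultimately show "\<exists>T. openin X T \<and> x \<in> T \<and> T \<subseteq> {x \<in> topspace X. \<rho> a x < e}"
    using openin_subset by (intro exI[of _ U]) blast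
qed

lemma openin_pm_outside:
  assumes "a \<in> topspace X" shows "openin X {x \<in> topspace X. e < \<rho> a x}"
  unfolding openin_subopen[of X "{x \<in> topspace X. e < \<rho> a x}"]
proof
  fix x assume x: "x \<in> {x \<in> topspace X. e < \<rho> a x}"
  then obtain U where U: "openin X U" "x \<in> U" "\<And>y. y \<in> U \<Longrightarrow> \<rho> x y < \<rho> a x - e"
    using pm_nhd[of x "\<rho> a x - e"] by auto
  moreover have "e < \<rho> a y" if "y \<in> U" for y
    using U(3)[OF that] pm_triangle[of a y x] pm_sym[of x y] x assms that openin_subset[OF U(1)]
    by force
  ultimately show "\<exists>T. openin X T \<and> x \<in> T \<and> T \<subseteq> {x \<in> topspace X. e < \<rho> a x}"
    using openin_subset by (intro exI[of _ U]) blast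
qed

text \<open>By commutativity the displacement is invariant, hence constant by minimality.\<close>

lemma pm_displacement:
  assumes "x \<in> topspace X" "y \<in> topspace X"
  shows "\<rho> (act g x) (act h x) = \<rho> (act g y) (act h y)"
proof -
  have le: "\<rho> (act g x) (act h x) \<le> \<rho> (act g y) (act h y)"
    if x: "x \<in> topspace X" and y: "y \<in> topspace X" for x y
  proof (rule field_le_epsilon)
    fix e :: real assume "e > 0"
    then have "{z \<in> topspace X. \<rho> y z < e/2} \<noteq> {}" using pm_refl[OF y] y by force
    then obtain f where f: "act f x \<in> {z \<in> topspace X. \<rho> y z < e/2}"
      by (rule orbit_meets_open[OF openin_pm_ball[OF y, of "e/2"] _ x])
    let ?z = "act f x"
    have z: "?z \<in> topspace X" by (simp add: act_closed x)
    have "\<rho> (act g x) (act h x) = \<rho> (act f (act g x)) (act f (act h x))"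
      by (simp add: pm_act act_closed x)
    also have "\<dots> = \<rho> (act g ?z) (act h ?z)"
      by (simp add: act_add[symmetric] x add.commute)
    also have "\<dots> \<le> \<rho> (act g ?z) (act g y) + (\<rho> (act g y) (act h y) + \<rho> (act h y) (act h ?z))"
      by (smt (verit) pm_triangle act_closed y z)
    also have "\<dots> \<le> \<rho> (act g y) (act h y) + e"
      using f pm_sym[OF y z] by (simp add: pm_act y z)
    finally show "\<rho> (act g x) (act h x) \<le> \<rho> (act g y) (act h y) + e" .
  qed
  show ?thesis using le[OF assms] le[OF assms(2,1)] by simp
qed

end

text \<open>For an invariant pseudometric this is the topology of the quotient metric space pulled
  back to X: every open set is a union of classes of points at distance zero.\<close>

definition pm_topology :: "('a \<Rightarrow> 'a \<Rightarrow> real) \<Rightarrow> 'a topology"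
  where "pm_topology \<rho> = topology (\<lambda>U. U \<subseteq> topspace X \<and>
    (\<forall>x\<in>U. \<exists>e>0. \<forall>y\<in>topspace X. \<rho> x y < e \<longrightarrow> y \<in> U))"

lemma openin_pm_topology:
  "openin (pm_topology \<rho>) U \<longleftrightarrow> U \<subseteq> topspace X \<and>
    (\<forall>x\<in>U. \<exists>e>0. \<forall>y\<in>topspace X. \<rho> x y < e \<longrightarrow> y \<in> U)"
proof -
  have "istopology (\<lambda>U. U \<subseteq> topspace X \<and> (\<forall>x\<in>U. \<exists>e>0. \<forall>y\<in>topspace X. \<rho> x y < e \<longrightarrow> y \<in> U))"
    unfolding istopology_def
  proof (rule conjI; intro allI impI)
    fix S T
    assume "S \<subseteq> topspace X \<and> (\<forall>x\<in>S. \<exists>e>0. \<forall>y\<in>topspace X. \<rho> x y < e \<longrightarrow> y \<in> S)"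
      "T \<subseteq> topspace X \<and> (\<forall>x\<in>T. \<exists>e>0. \<forall>y\<in>topspace X. \<rho> x y < e \<longrightarrow> y \<in> T)"
    note ST = this
    have "\<exists>e>0. \<forall>y\<in>topspace X. \<rho> x y < e \<longrightarrow> y \<in> S \<inter> T" if x: "x \<in> S \<inter> T" for x
    proof -
      obtain d e where "d > 0" "\<forall>y\<in>topspace X. \<rho> x y < d \<longrightarrow> y \<in> S"
        "e > 0" "\<forall>y\<in>topspace X. \<rho> x y < e \<longrightarrow> y \<in> T"
        using x ST by blast
      then show ?thesis by (intro exI[of _ "min d e"]) auto
    qed
    then show "S \<inter> T \<subseteq> topspace X \<and>
        (\<forall>x\<in>S \<inter> T. \<exists>e>0. \<forall>y\<in>topspace X. \<rho> x y < e \<longrightarrow> y \<in> S \<inter> T)"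
      using ST by blast
  next
    fix \<K>
    assume K: "\<forall>S\<in>\<K>. S \<subseteq> topspace X \<and> (\<forall>x\<in>S. \<exists>e>0. \<forall>y\<in>topspace X. \<rho> x y < e \<longrightarrow> y \<in> S)"
    have "\<exists>e>0. \<forall>y\<in>topspace X. \<rho> x y < e \<longrightarrow> y \<in> \<Union>\<K>" if S: "x \<in> S" "S \<in> \<K>" for x S
    proof -
      obtain e where "e > 0" "\<forall>y\<in>topspace X. \<rho> x y < e \<longrightarrow> y \<in> S" using K S by blast
      then show ?thesis using S(2) by (intro exI[of _ e]) blast
    qed
    with K show "\<Union>\<K> \<subseteq> topspace X \<and> (\<forall>x\<in>\<Union>\<K>. \<exists>e>0. \<forall>y\<in>topspace X. \<rho> x y < e \<longrightarrow> y \<in> \<Union>\<K>)"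
      by blast
  qed
  then show ?thesis by (simp add: pm_topology_def topology_inverse')
qed

lemma topspace_pm_topology: "topspace (pm_topology \<rho>) = topspace X"
proof -
  have "openin (pm_topology \<rho>) (topspace X)" by (auto simp: openin_pm_topology intro: zero_less_one)
  moreover have "topspace (pm_topology \<rho>) \<subseteq> topspace X"
    using openin_topspace[of "pm_topology \<rho>"] unfolding openin_pm_topology by (rule conjunct1)
  ultimately show ?thesis using openin_subset by blast
qed

lemma openin_pm_topology_imp:
  assumes "invariant_pseudometric \<rho>" "openin (pm_topology \<rho>) U" shows "openin X U"
  unfolding openin_subopen[of X U]
proof
  fix x assume "x \<in> U"
  then obtain e where e: "e > 0" "\<forall>y\<in>topspace X. \<rho> x y < e \<longrightarrow> y \<in> U" "x \<in> topspace X"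
    using assms(2) unfolding openin_pm_topology by blast
  then show "\<exists>T. openin X T \<and> x \<in> T \<and> T \<subseteq> U"
    using openin_pm_ball[OF assms(1) e(3), of e] pm_refl[OF assms(1) e(3)]
    by (intro exI[of _ "{y \<in> topspace X. \<rho> x y < e}"]) auto
qed

lemma coarse_pm_topology:
  assumes "invariant_pseudometric \<rho>" shows "invariant_coarsening (pm_topology \<rho>)"
  unfolding invariant_coarsening_def
proof (intro conjI allI impI)
  show "continuous_map (pm_topology \<rho>) (pm_topology \<rho>) (act g)" for g
    unfolding continuous_map_def
  proof (intro conjI allI impI)
    show "act g \<in> topspace (pm_topology \<rho>) \<rightarrow> topspace (pm_topology \<rho>)"
      by (simp add: topspace_pm_topology act_closed)
    fix U assume "openin (pm_topology \<rho>) U"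
    then show "openin (pm_topology \<rho>) {x \<in> topspace (pm_topology \<rho>). act g x \<in> U}"
      unfolding openin_pm_topology topspace_pm_topology
      by (auto simp: act_closed pm_act[OF assms]) (metis act_closed pm_act[OF assms])
  qed
qed (auto simp: topspace_pm_topology openin_pm_topology_imp[OF assms])

lemma openin_pm_topology_ball:
  assumes "invariant_pseudometric \<rho>" "a \<in> topspace X"
  shows "openin (pm_topology \<rho>) {x \<in> topspace X. \<rho> a x < e}"
  unfolding openin_pm_topology
proof (intro conjI ballI)
  fix x assume x: "x \<in> {x \<in> topspace X. \<rho> a x < e}"
  show "\<exists>d>0. \<forall>y\<in>topspace X. \<rho> x y < d \<longrightarrow> y \<in> {x \<in> topspace X. \<rho> a x < e}"
  proof (intro exI[of _ "e - \<rho> a x"] conjI ballI impI)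
    fix y assume "y \<in> topspace X" "\<rho> x y < e - \<rho> a x"
    then show "y \<in> {x \<in> topspace X. \<rho> a x < e}"
      using pm_triangle[OF assms(1,2), of x y] x by simp
  qed (use x in simp)
qed auto

text \<open>The sum describes a common extension of two factors, with a topology refining both by
  \<open>pm_topology_mono\<close>. It serves when a second pseudometric arises while a factor is
  already fixed.\<close>

lemma pseudometric_add:
  assumes "invariant_pseudometric \<rho>" "invariant_pseudometric \<sigma>"
  shows "invariant_pseudometric (\<lambda>x y. \<rho> x y + \<sigma> x y)"
  unfolding invariant_pseudometric_def
proof (intro conjI ballI allI impI)
  show "\<rho> x z + \<sigma> x z \<le> \<rho> x y + \<sigma> x y + (\<rho> y z + \<sigma> y z)"
    if "x \<in> topspace X" "y \<in> topspace X" "z \<in> topspace X" for x y z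
    using pm_triangle[OF assms(1) that] pm_triangle[OF assms(2) that] by simp
  fix x and e :: real assume x: "x \<in> topspace X" and "e > 0"
  then have e: "e/2 > 0" by simp
  obtain U V where "openin X U" "x \<in> U" "\<And>y. y \<in> U \<Longrightarrow> \<rho> x y < e/2"
      "openin X V" "x \<in> V" "\<And>y. y \<in> V \<Longrightarrow> \<sigma> x y < e/2"
    using pm_nhd[OF assms(1) x e] pm_nhd[OF assms(2) x e] by metis
  then show "\<exists>U. openin X U \<and> x \<in> U \<and> (\<forall>y\<in>U. \<rho> x y + \<sigma> x y < e)"
    by (intro exI[of _ "U \<inter> V"]) fastforce
qed (use assms pm_sym in \<open>auto simp: pm_refl pm_act\<close>)

lemma pm_topology_mono:
  assumes "invariant_pseudometric \<sigma>" "openin (pm_topology \<rho>) U"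
  shows "openin (pm_topology (\<lambda>x y. \<rho> x y + \<sigma> x y)) U"
  unfolding openin_pm_topology
proof (intro conjI ballI)
  show "U \<subseteq> topspace X" using assms(2) by (simp add: openin_pm_topology)
  fix x assume "x \<in> U"
  then obtain e where "e > 0" "\<forall>y\<in>topspace X. \<rho> x y < e \<longrightarrow> y \<in> U" "x \<in> topspace X"
    using assms(2) unfolding openin_pm_topology by blast
  then show "\<exists>e>0. \<forall>y\<in>topspace X. \<rho> x y + \<sigma> x y < e \<longrightarrow> y \<in> U"
    using pm_nonneg[OF assms(1)] by (smt (verit))
qed

text \<open>On every isometric factor, arbitrary group elements g_i can be approximated
  simultaneously by the t_i at a common time n. By \<open>pm_displacement\<close> closeness at one
  point x is closeness at all points, so this is density in a power of a compact abelian
  group.\<close>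

definition bohr_dense :: "'i set \<Rightarrow> ('i \<Rightarrow> int \<Rightarrow> 'g) \<Rightarrow> bool"
  where "bohr_dense I t \<longleftrightarrow> (\<forall>\<rho> g. \<forall>x\<in>topspace X. \<forall>e>0. invariant_pseudometric \<rho> \<longrightarrow>
    (\<exists>n. \<forall>i\<in>I. \<rho> (act (t i n) x) (act (g i) x) < e))"

lemma bohr_denseD:
  assumes "bohr_dense I t" "x \<in> topspace X" "e > 0" "invariant_pseudometric \<rho>"
  obtains n where "\<And>i. i \<in> I \<Longrightarrow> \<rho> (act (t i n) x) (act (g i) x) < e"
  using assms unfolding bohr_dense_def by metis

text \<open>Test product transitivity on balls of radius e/2 around x and around the points g_i x.
  Time n acts isometrically, so replacing the visiting point u by x costs no more than the distance
  from x to u.\<close>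

lemma prod_transitive_imp_bohr_dense:
  assumes "prod_transitive I (\<lambda>_. X) t" shows "bohr_dense I t"
  unfolding bohr_dense_def
proof (intro allI ballI impI)
  fix \<rho> g x and e :: real
  assume x: "x \<in> topspace X" and e: "e > 0" and \<rho>: "invariant_pseudometric \<rho>"
  let ?B = "\<lambda>y. {z \<in> topspace X. \<rho> y z < e/2}"
  have op: "openin X (?B y)" if "y \<in> topspace X" for y using openin_pm_ball[OF \<rho> that] .
  have ne: "?B y \<noteq> {}" if "y \<in> topspace X" for y using that e pm_refl[OF \<rho> that] by force
  have "\<exists>n. \<forall>i\<in>I. \<exists>u\<in>?B x. act (t i n) u \<in> ?B (act (g i) x)"
    by (intro prod_transitiveD[OF assms] op ne act_closed x)
  then obtain n where n: "\<And>i. i \<in> I \<Longrightarrow> \<exists>u\<in>?B x. act (t i n) u \<in> ?B (act (g i) x)" by blast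
  have "\<rho> (act (t i n) x) (act (g i) x) < e" if i: "i \<in> I" for i
  proof -
    obtain u where u: "u \<in> topspace X" "\<rho> x u < e/2" "\<rho> (act (g i) x) (act (t i n) u) < e/2"
      using n[OF i] by blast
    have "\<rho> (act (t i n) x) (act (g i) x)
        \<le> \<rho> (act (t i n) x) (act (t i n) u) + \<rho> (act (t i n) u) (act (g i) x)"
      by (intro pm_triangle[OF \<rho>] act_closed x u)
    also have "\<dots> = \<rho> x u + \<rho> (act (g i) x) (act (t i n) u)"
      using pm_act[OF \<rho> x u(1)] pm_sym[OF \<rho>] act_closed x u(1) by metis
    finally show ?thesis using u by simp
  qed
  then show "\<exists>n. \<forall>i\<in>I. \<rho> (act (t i n) x) (act (g i) x) < e" by blast
qed

text \<open>Ask t to approximate g with its entry j changed to 0. Then t_j n nearly fixes x, hence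
  by constant displacement also every g_i x, and removing t_j n from t_i n costs less than a further
  e/2.\<close>

lemma bohr_dense_diff:
  assumes "bohr_dense I t" "j \<in> I"
  shows "bohr_dense (I - {j}) (\<lambda>i n. t i n - t j n)"
  unfolding bohr_dense_def
proof (intro allI ballI impI)
  fix \<rho> g x and e :: real
  assume x: "x \<in> topspace X" and e: "e > 0" and \<rho>: "invariant_pseudometric \<rho>"
  obtain n where n: "\<And>i. i \<in> I \<Longrightarrow> \<rho> (act (t i n) x) (act ((g(j := 0)) i) x) < e/2"
    using bohr_denseD[OF assms(1) x _ \<rho>] e by (metis half_gt_zero)
  have "\<rho> (act (t i n - t j n) x) (act (g i) x) < e" if i: "i \<in> I - {j}" for i
  proof -
    let ?y = "act (g i) x"
    have y: "?y \<in> topspace X" by (simp add: act_closed x)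
    have "\<rho> (act (t i n - t j n) x) ?y = \<rho> (act (t j n) (act (t i n - t j n) x)) (act (t j n) ?y)"
      by (simp add: pm_act[OF \<rho>] act_closed x)
    also have "\<dots> = \<rho> (act (t i n) x) (act (t j n) ?y)"
      by (simp add: act_add[symmetric] x)
    also have "\<dots> \<le> \<rho> (act (t i n) x) ?y + \<rho> ?y (act (t j n) ?y)"
      by (intro pm_triangle[OF \<rho>] act_closed x)
    also have "\<rho> ?y (act (t j n) ?y) = \<rho> (act (t j n) ?y) (act 0 ?y)"
      using pm_sym[OF \<rho>] act_closed[OF y] y by (simp add: act_zero)
    also have "\<dots> = \<rho> (act (t j n) x) (act 0 x)" by (rule pm_displacement[OF \<rho> y x])
    finally show ?thesis using n[of i] n[OF assms(2)] i by simp
  qed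
  then show "\<exists>n. \<forall>i\<in>I - {j}. \<rho> (act (t i n - t j n) x) (act (g i) x) < e" by blast
qed

end

section \<open>Invariant means and slices of invariant relations\<close>

definition mean_on :: "'a set \<Rightarrow> ('a set \<Rightarrow> real) \<Rightarrow> bool"
  where "mean_on S \<mu> \<longleftrightarrow> \<mu> S = 1 \<and> (\<forall>A. A \<subseteq> S \<longrightarrow> 0 \<le> \<mu> A) \<and>
    (\<forall>A B. A \<subseteq> S \<and> B \<subseteq> S \<and> A \<inter> B = {} \<longrightarrow> \<mu> (A \<union> B) = \<mu> A + \<mu> B)"

lemma mean_on_add:
  "\<lbrakk>mean_on S \<mu>; A \<subseteq> S; B \<subseteq> S; A \<inter> B = {}\<rbrakk> \<Longrightarrow> \<mu> (A \<union> B) = \<mu> A + \<mu> B"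
  by (simp add: mean_on_def)

lemma mean_on_mono: "\<lbrakk>mean_on S \<mu>; B \<subseteq> S; A \<subseteq> B\<rbrakk> \<Longrightarrow> \<mu> A \<le> \<mu> B"
  using mean_on_add[of S \<mu> A "B - A"] unfolding mean_on_def
  by (smt (verit) Diff_disjoint Diff_partition Diff_subset subset_trans)

lemma mean_on_modular:
  assumes "mean_on S \<mu>" "A \<subseteq> S" "B \<subseteq> S"
  shows "\<mu> (A \<union> B) + \<mu> (A \<inter> B) = \<mu> A + \<mu> B"
proof -
  have "\<mu> (A \<union> B) = \<mu> A + \<mu> (B - A)"
    using mean_on_add[OF assms(1,2), of "B - A"] assms(3) by (simp add: Un_Diff_cancel subset_iff)
  moreover have "A \<inter> B \<union> (B - A) = B" by blast
  then have "\<mu> B = \<mu> (A \<inter> B) + \<mu> (B - A)"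
    using mean_on_add[OF assms(1), of "A \<inter> B" "B - A"] assms(2,3) by force
  ultimately show ?thesis by simp
qed

locale minimal_action_mean = minimal_abelian_action X act
  for X :: "'a topology" and act :: "'g::ab_group_add \<Rightarrow> 'a \<Rightarrow> 'a" +
  fixes \<mu> :: "'a set \<Rightarrow> real"
  assumes mean: "mean_on (topspace X) \<mu>"
    and mean_pre: "A \<subseteq> topspace X \<Longrightarrow> \<mu> (pre g A) = \<mu> A"
begin

text \<open>Finite additivity does not bound the mean of a closed set by that of a small open
  neighbourhood. The infimum over open supersets builds this in, so that slices trapped in a fixed
  open set have controlled content.\<close>

definition content :: "'a set \<Rightarrow> real"
  where "content C = (INF U\<in>{U. openin X U \<and> C \<subseteq> U}. \<mu> U)"

lemma mean_nonneg: "openin X U \<Longrightarrow> 0 \<le> \<mu> U"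
  using mean openin_subset[of X U] unfolding mean_on_def by simp

lemma bdd_below_open_means: "bdd_below (\<mu> ` {U. openin X U \<and> C \<subseteq> U})"
  using mean_nonneg by (auto intro!: bdd_belowI[of _ 0])

lemma content_le: "\<lbrakk>openin X U; C \<subseteq> U\<rbrakk> \<Longrightarrow> content C \<le> \<mu> U"
  unfolding content_def by (rule cINF_lower[OF bdd_below_open_means]) auto

lemma content_approx:
  assumes "C \<subseteq> topspace X" "e > 0"
  obtains U where "openin X U" "C \<subseteq> U" "\<mu> U < content C + e"
proof -
  have "{U. openin X U \<and> C \<subseteq> U} \<noteq> {}" using assms(1) by blast
  then have "\<exists>U\<in>{U. openin X U \<and> C \<subseteq> U}. \<mu> U < content C + e"
    using cINF_less_iff[OF _ bdd_below_open_means, of C "content C + e"] assms(2)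
    unfolding content_def by simp
  then show ?thesis using that by blast
qed

lemma content_nonneg: "C \<subseteq> topspace X \<Longrightarrow> 0 \<le> content C"
  unfolding content_def using mean_nonneg by (intro cINF_greatest) auto

lemma content_mono:
  assumes "D \<subseteq> topspace X" "C \<subseteq> D" shows "content C \<le> content D"
proof (rule field_le_epsilon)
  fix e :: real assume "e > 0"
  then obtain U where "openin X U" "D \<subseteq> U" "\<mu> U < content D + e"
    using content_approx[OF assms(1)] by blast
  then show "content C \<le> content D + e" using content_le[of U C] assms(2) by force
qed

lemma content_topspace: "content (topspace X) = 1"
proof (rule antisym)
  have one: "\<mu> (topspace X) = 1" using mean by (simp add: mean_on_def)
  then show "content (topspace X) \<le> 1" using content_le[of "topspace X" "topspace X"] by simp
  show "1 \<le> content (topspace X)"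
    unfolding content_def using one by (intro cINF_greatest) (auto dest!: openin_subset dest: subset_antisym)
qed

text \<open>The mean is modular, and nearly optimal open supersets of A and B have a union and an
  intersection that are open supersets of the union and the intersection.\<close>

lemma content_submodular:
  assumes "A \<subseteq> topspace X" "B \<subseteq> topspace X"
  shows "content (A \<union> B) + content (A \<inter> B) \<le> content A + content B"
proof (rule field_le_epsilon)
  fix e :: real assume "e > 0"
  then have e: "e/2 > 0" by simp
  obtain U where U: "openin X U" "A \<subseteq> U" "\<mu> U < content A + e/2"
    using content_approx[OF assms(1) e] by blast
  obtain V where V: "openin X V" "B \<subseteq> V" "\<mu> V < content B + e/2"
    using content_approx[OF assms(2) e] by blast
  have "content (A \<union> B) + content (A \<inter> B) \<le> \<mu> (U \<union> V) + \<mu> (U \<inter> V)"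
    using U V by (intro add_mono content_le) auto
  also have "\<dots> = \<mu> U + \<mu> V"
    using mean_on_modular[OF mean] openin_subset[OF U(1)] openin_subset[OF V(1)] by blast
  finally show "content (A \<union> B) + content (A \<inter> B) \<le> content A + content B + e"
    using U V by simp
qed

lemma content_subadditive:
  "\<lbrakk>A \<subseteq> topspace X; B \<subseteq> topspace X\<rbrakk> \<Longrightarrow> content (A \<union> B) \<le> content A + content B"
  using content_submodular[of A B] content_nonneg[of "A \<inter> B"] by (simp add: inf.coboundedI1)

text \<open>Disjoint compact sets have disjoint open neighbourhoods, and these cut disjoint pieces
  out of any open superset of the union.\<close>

lemma content_superadditive:
  assumes "closedin X A" "closedin X B" "A \<inter> B = {}"
  shows "content A + content B \<le> content (A \<union> B)"
proof (rule field_le_epsilon)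
  fix e :: real assume "e > 0"
  then obtain W where W: "openin X W" "A \<union> B \<subseteq> W" "\<mu> W < content (A \<union> B) + e"
    using content_approx[of "A \<union> B" e] closedin_subset[OF assms(1)] closedin_subset[OF assms(2)]
    by auto
  have "compactin X A" "compactin X B" "disjnt A B"
    using closedin_compact_space[OF compact] assms by (auto simp: disjnt_def)
  then obtain U V where UV: "openin X U" "openin X V" "A \<subseteq> U" "B \<subseteq> V" "disjnt U V"
    using Hausdorff unfolding Hausdorff_space_compact_sets by metis
  have "content A + content B \<le> \<mu> (U \<inter> W) + \<mu> (V \<inter> W)"
    using UV W by (intro add_mono content_le) auto
  also have "\<dots> = \<mu> ((U \<inter> W) \<union> (V \<inter> W))"
    using UV(5) openin_subset[OF W(1)]
    by (intro mean_on_add[OF mean, symmetric]) (auto simp: disjnt_def)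
  also have "\<dots> \<le> \<mu> W"
    using openin_subset[OF W(1)] by (intro mean_on_mono[OF mean]) auto
  finally show "content A + content B \<le> content (A \<union> B) + e" using W by simp
qed

lemma pre_pre: "C \<subseteq> topspace X \<Longrightarrow> pre (- g) (pre g C) = C"
  by (auto simp: pre_def act_closed act_minus act_minus')

lemma content_pre:
  assumes "C \<subseteq> topspace X" shows "content (pre g C) = content C"
proof -
  have le: "content (pre g C) \<le> content C" if C: "C \<subseteq> topspace X" for g C
  proof (rule field_le_epsilon)
    fix e :: real assume "e > 0"
    then obtain U where U: "openin X U" "C \<subseteq> U" "\<mu> U < content C + e"
      using content_approx[OF C] by blast
    then have "content (pre g C) \<le> \<mu> (pre g U)"
      by (intro content_le openin_pre) (auto simp: pre_def)
    then show "content (pre g C) \<le> content C + e"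
      using U mean_pre[OF openin_subset[OF U(1)]] by simp
  qed
  show ?thesis
    \<comment> \<open>The reverse inequality is the same one for the inverse translation.\<close>
    using le[OF assms, of g] le[OF pre_subset, of "- g" g C] pre_pre[OF assms] by simp
qed

lemma content_null_Union:
  assumes "finite F" "\<And>A. A \<in> F \<Longrightarrow> A \<subseteq> topspace X \<and> content A = 0"
  shows "content (\<Union>F) = 0"
  using assms
proof (induction)
  case empty
  have "content {} \<le> \<mu> {}" by (rule content_le) auto
  moreover have "\<mu> {} = 0" using mean_on_add[OF mean, of "{}" "{}"] by simp
  ultimately show ?case using content_nonneg[of "{}"] by simp
next
  case (insert A F)
  then have s: "A \<subseteq> topspace X" "\<Union>F \<subseteq> topspace X" "content A = 0" "content (\<Union>F) = 0" by auto
  have "content (\<Union>(insert A F)) \<le> 0" "\<Union>(insert A F) \<subseteq> topspace X"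
    using content_subadditive[OF s(1,2)] s by auto
  then show ?case using content_nonneg[of "\<Union>(insert A F)"] by linarith
qed

text \<open>The model is the closure of a union of graphs of maps from the acting group, which is
  invariant under the diagonal action by commutativity.\<close>

definition invariant_relation :: "('a \<times> 'a) set \<Rightarrow> bool"
  where "invariant_relation W \<longleftrightarrow> closedin (prod_topology X X) W \<and>
    (\<forall>x y g. (x, y) \<in> W \<longrightarrow> (act g x, act g y) \<in> W)"

section \<open>Slices of a closed invariant relation\<close>

context
  fixes W assumes W: "invariant_relation W"
begin

lemma relation_closed: "closedin (prod_topology X X) W"
  using W by (simp add: invariant_relation_def)

lemma relation_subset: "W \<subseteq> topspace X \<times> topspace X"
  using closedin_subset[OF relation_closed] by simp

lemma closedin_slice:
  assumes "y \<in> topspace X" shows "closedin X (W `` {y})"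
proof -
  have "continuous_map X (prod_topology X X) (\<lambda>x. (y, x))"
    using assms by (intro continuous_map_pairedI) auto
  from closedin_continuous_map_preimage[OF this relation_closed]
  have "closedin X {x \<in> topspace X. (y, x) \<in> W}" .
  moreover have "{x \<in> topspace X. (y, x) \<in> W} = W `` {y}"
    using relation_subset by auto
  ultimately show ?thesis by simp
qed

lemma slice_subset: "W `` A \<subseteq> topspace X"
  using relation_subset by auto

lemma slice_act:
  assumes "y \<in> topspace X" shows "W `` {act g y} = pre (- g) (W `` {y})"
proof
  have inv: "(act g x, act g z) \<in> W" if "(x, z) \<in> W" for x z g
    using W that by (simp add: invariant_relation_def)
  show "W `` {act g y} \<subseteq> pre (- g) (W `` {y})"
  proof
    fix x assume "x \<in> W `` {act g y}"
    then have "(act (- g) (act g y), act (- g) x) \<in> W" "x \<in> topspace X"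
      using inv relation_subset by auto
    then show "x \<in> pre (- g) (W `` {y})" by (simp add: pre_def act_minus assms)
  qed
  show "pre (- g) (W `` {y}) \<subseteq> W `` {act g y}"
  proof
    fix x assume "x \<in> pre (- g) (W `` {y})"
    then have x: "x \<in> topspace X" "(y, act (- g) x) \<in> W" by (auto simp: pre_def)
    from inv[OF x(2), of g] show "x \<in> W `` {act g y}" by (simp add: act_minus' x(1))
  qed
qed

text \<open>Tube lemma: by compactness of X the first projection is a closed map, and the part of W
  with second coordinate outside U projects to a closed set missing y.\<close>

lemma slice_upper_semicontinuous:
  assumes "y \<in> topspace X" "openin X U" "W `` {y} \<subseteq> U"
  obtains N where "openin X N" "y \<in> N" "W `` N \<subseteq> U"
proof -
  have "closedin (prod_topology X X) (topspace X \<times> (topspace X - U))"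
    using assms(2) by (simp add: closedin_prod_Times_iff closedin_diff)
  then have "closedin (prod_topology X X) (W \<inter> topspace X \<times> (topspace X - U))"
    using relation_closed by blast
  then have cl: "closedin X (fst ` (W \<inter> topspace X \<times> (topspace X - U)))" (is "closedin X ?K")
    using closed_map_fst[OF compact, of X] unfolding closed_map_def by blast
  have "y \<notin> ?K" using assms(3) by auto
  moreover have "W `` (topspace X - ?K) \<subseteq> U" using relation_subset by force
  ultimately show ?thesis using that[of "topspace X - ?K"] cl assms(1) by blast
qed

lemma content_slice_nhd:
  assumes "y \<in> topspace X" "e > 0"
  obtains N where "openin X N" "y \<in> N"
    "\<And>z. z \<in> N \<Longrightarrow> content (W `` {y} \<union> W `` {z}) < content (W `` {y}) + e"
proof -
  obtain U where U: "openin X U" "W `` {y} \<subseteq> U" "\<mu> U < content (W `` {y}) + e"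
    using content_approx[OF slice_subset assms(2)] by blast
  obtain N where N: "openin X N" "y \<in> N" "W `` N \<subseteq> U"
    using slice_upper_semicontinuous[OF assms(1) U(1,2)] by blast
  have "content (W `` {y} \<union> W `` {z}) < content (W `` {y}) + e" if "z \<in> N" for z
    using content_le[OF U(1), of "W `` {y} \<union> W `` {z}"] U N(3) that by force
  then show ?thesis using that N by blast
qed

lemma content_slice_act: "y \<in> topspace X \<Longrightarrow> content (W `` {act g y}) = content (W `` {y})"
  by (simp add: slice_act content_pre slice_subset)

text \<open>The content of slices is invariant and, by \<open>content_slice_nhd\<close>, upper
  semicontinuous. Moving x close to y along its orbit bounds the first value by the second, and the
  roles can be exchanged.\<close>

lemma content_slice_constant:
  assumes "x \<in> topspace X" "y \<in> topspace X"
  shows "content (W `` {x}) = content (W `` {y})"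
proof -
  have le: "content (W `` {x}) \<le> content (W `` {y})"
    if x: "x \<in> topspace X" and y: "y \<in> topspace X" for x y
  proof (rule field_le_epsilon)
    fix e :: real assume "e > 0"
    then obtain N where N: "openin X N" "y \<in> N"
      "\<And>z. z \<in> N \<Longrightarrow> content (W `` {y} \<union> W `` {z}) < content (W `` {y}) + e"
      using content_slice_nhd[OF y] by blast
    then obtain g where g: "act g x \<in> N" using orbit_meets_open[OF N(1) _ x] by blast
    have "content (W `` {x}) = content (W `` {act g x})" by (simp add: content_slice_act x)
    also have "\<dots> \<le> content (W `` {y} \<union> W `` {act g x})"
      using slice_subset by (intro content_mono) auto
    finally show "content (W `` {x}) \<le> content (W `` {y}) + e" using N(3)[OF g] by simp
  qed
  show ?thesis using le assms by (meson antisym)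
qed

text \<open>Plays the role of the measure of the second slice minus the first. Since all slices have
  equal content, this is half the measure of the symmetric difference in the measure-theoretic
  picture. Unions are used so that submodularity applies directly.\<close>

definition slice_distance :: "'a \<Rightarrow> 'a \<Rightarrow> real"
  where "slice_distance x y = content (W `` {x} \<union> W `` {y}) - content (W `` {x})"

text \<open>Symmetry is the constancy of slice contents. The triangle inequality is submodularity
  for the union of slices x and y against that of slices y and z, whose intersection contains the
  slice of y.\<close>

lemma pseudometric_slice_distance: "invariant_pseudometric slice_distance"
  unfolding invariant_pseudometric_def
proof (intro conjI ballI allI impI)
  fix x assume x: "x \<in> topspace X"
  show "slice_distance x x = 0" by (simp add: slice_distance_def)
  fix y assume y: "y \<in> topspace X"
  show "slice_distance x y = slice_distance y x"
    using content_slice_constant[OF x y] by (simp add: slice_distance_def Un_commute)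
  show "slice_distance (act g x) (act g y) = slice_distance x y" for g
  proof -
    have "W `` {act g x} \<union> W `` {act g y} = pre (- g) (W `` {x} \<union> W `` {y})"
      unfolding slice_act[OF x] slice_act[OF y] by (auto simp: pre_def)
    moreover have "W `` {x} \<union> W `` {y} \<subseteq> topspace X" using slice_subset by auto
    ultimately show ?thesis
      by (simp add: slice_distance_def content_slice_act x content_pre)
  qed
  fix z assume z: "z \<in> topspace X"
  let ?A = "W `` {x}" and ?B = "W `` {y}" and ?C = "W `` {z}"
  have sub: "?A \<subseteq> topspace X" "?B \<subseteq> topspace X" "?C \<subseteq> topspace X"
    using slice_subset by auto
  have "content (?A \<union> ?C) + content ?B
      \<le> content ((?A \<union> ?B) \<union> (?B \<union> ?C)) + content ((?A \<union> ?B) \<inter> (?B \<union> ?C))"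
    using sub by (intro add_mono content_mono) auto
  also have "\<dots> \<le> content (?A \<union> ?B) + content (?B \<union> ?C)"
    using sub by (intro content_submodular) auto
  finally show "slice_distance x z \<le> slice_distance x y + slice_distance y z"
    by (simp add: slice_distance_def)
next
  fix x and e :: real assume "x \<in> topspace X" "e > 0"
  then obtain N where "openin X N" "x \<in> N"
    "\<And>z. z \<in> N \<Longrightarrow> content (W `` {x} \<union> W `` {z}) < content (W `` {x}) + e"
    using content_slice_nhd by blast
  then show "\<exists>U. openin X U \<and> x \<in> U \<and> (\<forall>y\<in>U. slice_distance x y < e)"
    by (intro exI[of _ N]) (auto simp: slice_distance_def algebra_simps)
qed

text \<open>The part of slice y in C is closed and disjoint from slice z, so its content adds to
  that of slice z. The sum is at most the content of the union of both slices, which distance zero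
  makes equal to that of slice z alone.\<close>

lemma slice_null:
  assumes "y \<in> topspace X" "z \<in> topspace X" "slice_distance y z = 0"
    and "closedin X C" "W `` {z} \<inter> C = {}"
  shows "content (W `` {y} \<inter> C) = 0"
proof -
  have cl: "closedin X (W `` {y} \<inter> C)" using closedin_slice[OF assms(1)] assms(4) by blast
  have "content (W `` {y} \<inter> C) + content (W `` {z}) \<le> content ((W `` {y} \<inter> C) \<union> W `` {z})"
    using assms(5) by (intro content_superadditive cl closedin_slice assms) auto
  also have "\<dots> \<le> content (W `` {y} \<union> W `` {z})"
    using slice_subset by (intro content_mono) auto
  also have "\<dots> = content (W `` {z})"
    using assms(3) content_slice_constant[OF assms(1,2)] by (simp add: slice_distance_def)
  finally have "content (W `` {y} \<inter> C) \<le> 0" by simp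
  then show ?thesis using content_nonneg[of "W `` {y} \<inter> C"] slice_subset by force
qed

end

end

section \<open>Product transitivity and joint visits\<close>

context minimal_action_mean
begin

section \<open>Compactness arguments for pseudometrics\<close>

lemma compact_pm_gap:
  assumes \<rho>: "invariant_pseudometric \<rho>" and "closedin X K" "z \<in> topspace X"
    and pos: "\<And>x. x \<in> K \<Longrightarrow> 0 < \<rho> z x"
  obtains e where "e > 0" "\<And>x. x \<in> K \<Longrightarrow> e < \<rho> z x"
proof -
  define P where "P n = {x \<in> topspace X. 1 / real (Suc n) < \<rho> z x}" for n
  have "openin X U" if "U \<in> range P" for U
    using that openin_pm_outside[OF \<rho> assms(3)] by (auto simp: P_def)
  moreover have "K \<subseteq> \<Union>(range P)"
  proof
    fix x assume x: "x \<in> K"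
    then obtain n where "1 / real (Suc n) < \<rho> z x"
      using pos nat_approx_posE by blast
    moreover have "x \<in> topspace X" using x closedin_subset[OF assms(2)] by blast
    ultimately show "x \<in> \<Union>(range P)" by (auto simp: P_def)
  qed
  ultimately obtain \<F> where \<F>: "finite \<F>" "\<F> \<subseteq> range P" "K \<subseteq> \<Union>\<F>"
    using compactinD[OF closedin_compact_space[OF compact assms(2)], of "range P"] by blast
  obtain N where N: "finite N" "\<F> = P ` N"
    using finite_subset_image[OF \<F>(1,2)] by blast
  show ?thesis
  \<comment> \<open>\<open>insert 0\<close> keeps the maximum meaningful when the subcover is empty,
    as may happen for empty K.\<close>
  proof (rule that[of "1 / real (Suc (Max (insert 0 N)))"])
    fix x assume "x \<in> K"
    then obtain n where n: "n \<in> N" "1 / real (Suc n) < \<rho> z x"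
      using \<F>(3) N(2) by (auto simp: P_def)
    have "n \<le> Max (insert 0 N)" using n(1) N(1) by (intro Max_ge) auto
    then have "1 / real (Suc (Max (insert 0 N))) \<le> 1 / real (Suc n)"
      by (intro divide_left_mono) auto
    with n(2) show "1 / real (Suc (Max (insert 0 N))) < \<rho> z x" by simp
  qed simp
qed

lemma regular: "regular_space X"
  using compact_Hausdorff_imp_regular_space[OF compact Hausdorff] .

lemma closed_neighbourhood:
  assumes "openin X U" "x \<in> U"
  obtains N C where "openin X N" "closedin X C" "x \<in> N" "N \<subseteq> C" "C \<subseteq> U"
  using regular assms unfolding neighbourhood_base_of_closedin[symmetric] neighbourhood_base_of
  by metis

text \<open>In the quotient metric space the image of an open set has interior, by a Baire argument:
  finitely many translates of a smaller closed set cover.\<close>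

lemma pm_saturation_interior:
  assumes \<rho>: "invariant_pseudometric \<rho>" and V: "openin X V" "V \<noteq> {}"
  obtains a e where "a \<in> V" "e > 0"
    "\<And>z. \<lbrakk>z \<in> topspace X; \<rho> a z < e\<rbrakk> \<Longrightarrow> \<exists>v\<in>V. \<rho> z v = 0"
proof (rule ccontr)
  assume "\<not> thesis"
  with that have contra: "\<exists>z\<in>topspace X. \<rho> a z < e \<and> (\<forall>v\<in>V. \<rho> z v \<noteq> 0)"
    if "a \<in> V" "e > 0" for a e using that by blast
  obtain x where "x \<in> V" using V(2) by blast
  then obtain N K where N: "openin X N" "closedin X K" "x \<in> N" "N \<subseteq> K" "K \<subseteq> V"
    using closed_neighbourhood[OF V(1)] by metis
  have KX: "K \<subseteq> topspace X" by (rule closedin_subset[OF N(2)])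
  let ?Y = "pm_topology \<rho>"
  \<comment> \<open>The points whose class misses K. The assumed failure of the claim will make this
    set open and dense in the factor.\<close>
  define Q where "Q = {z \<in> topspace X. \<forall>v\<in>K. \<rho> z v \<noteq> 0}"
  have Q: "openin ?Y Q"
    unfolding openin_pm_topology
  proof (intro conjI ballI)
    fix z assume z: "z \<in> Q"
    then have zX: "z \<in> topspace X" by (simp add: Q_def)
    have "0 < \<rho> z v" if "v \<in> K" for v
      using z that pm_nonneg[OF \<rho> zX, of v] KX by (force simp: Q_def)
    then obtain e where e: "e > 0" "\<And>v. v \<in> K \<Longrightarrow> e < \<rho> z v"
      using compact_pm_gap[OF \<rho> N(2) zX] by metis
    have "y \<in> Q" if y: "y \<in> topspace X" "\<rho> z y < e" for y
    proof -
      have "\<rho> y v \<noteq> 0" if v: "v \<in> K" for v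
        using pm_triangle[OF \<rho> zX y(1), of v] e(2)[OF v] y(2) v KX by force
      then show ?thesis using y(1) by (simp add: Q_def)
    qed
    then show "\<exists>e>0. \<forall>y\<in>topspace X. \<rho> z y < e \<longrightarrow> y \<in> Q" using e(1) by blast
  qed (auto simp: Q_def)
  \<comment> \<open>If B missed Q, a point of B would be at distance zero from some v in K; the
    failure of the claim near v then produces a point of B inside Q after all.\<close>
  have meets: "B \<inter> Q \<noteq> {}" if B: "openin ?Y B" "B \<noteq> {}" for B
  proof (rule ccontr)
    assume "\<not> B \<inter> Q \<noteq> {}"
    then have BQ: "B \<inter> Q = {}" by simp
    obtain z where z: "z \<in> B" using B(2) by blast
    then obtain e where e: "e > 0" "\<And>y. \<lbrakk>y \<in> topspace X; \<rho> z y < e\<rbrakk> \<Longrightarrow> y \<in> B"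
        and zX: "z \<in> topspace X"
      using B(1) unfolding openin_pm_topology by blast
    obtain v where v: "v \<in> K" "\<rho> z v = 0" using z BQ zX by (auto simp: Q_def)
    then obtain y where y: "y \<in> topspace X" "\<rho> v y < e" "\<forall>v\<in>V. \<rho> y v \<noteq> 0"
      using contra[of v e] e(1) N(5) by blast
    have "\<rho> z y < e" using pm_triangle[OF \<rho> zX _ y(1), of v] v y(2) KX by force
    then have "y \<in> B" using e(2) y(1) by blast
    moreover have "y \<in> Q" using y N(5) by (auto simp: Q_def)
    ultimately show False using BQ by blast
  qed
  have Y: "invariant_coarsening ?Y" by (rule coarse_pm_topology[OF \<rho>])
  \<comment> \<open>The finite case of Baire: finitely many translates of the open dense set Q have
    a nonempty open set in common.\<close>
  have avoid: "\<exists>B. openin ?Y B \<and> B \<noteq> {} \<and> (\<forall>g\<in>F. \<forall>x\<in>B. act g x \<in> Q)" if "finite F" for F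
    using that
  proof induction
    case empty
    have "openin ?Y (topspace X)" by (metis openin_topspace topspace_pm_topology)
    then show ?case using \<open>x \<in> V\<close> openin_subset[OF V(1)] by blast
  next
    case (insert g F)
    then obtain B where B: "openin ?Y B" "B \<noteq> {}" "\<forall>g\<in>F. \<forall>x\<in>B. act g x \<in> Q" by blast
    have BX: "B \<subseteq> topspace X" using B(1) by (simp add: openin_pm_topology)
    obtain b where "b \<in> B" using B(2) by blast
    then have "act g b \<in> pre (- g) B" using BX by (auto simp: pre_def act_closed act_minus)
    then obtain y where y: "y \<in> pre (- g) B" "y \<in> Q"
      using meets[OF coarse_pre[OF Y B(1), of "- g"]] by blast
    then have "act (- g) y \<in> B \<inter> pre g Q"
      using BX by (auto simp: pre_def act_minus')
    moreover have "openin ?Y (B \<inter> pre g Q)" using B(1) coarse_pre[OF Y Q] by blast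
    ultimately show ?case using B(3) by (intro exI[of _ "B \<inter> pre g Q"]) (auto simp: pre_def)
  qed
  \<comment> \<open>Every point is moved into N, inside K, by some g in F, whereas a point of B is
    moved into Q by all of F. A point of K at nonzero distance from itself results.\<close>
  obtain F where F: "finite F" "\<And>x. x \<in> topspace X \<Longrightarrow> \<exists>g\<in>F. act g x \<in> N"
    using finite_translates_cover[of N] N by blast
  obtain B b where B: "openin ?Y B" "b \<in> B" "\<forall>g\<in>F. \<forall>x\<in>B. act g x \<in> Q"
    using avoid[OF F(1)] by blast
  have bX: "b \<in> topspace X" using B(1,2) by (auto simp: openin_pm_topology)
  obtain g where g: "g \<in> F" "act g b \<in> N" using F(2)[OF bX] by blast
  then have "act g b \<in> Q" "act g b \<in> K" using B N(4) by auto
  then show False using pm_refl[OF \<rho> act_closed[OF bX, of g]] by (force simp: Q_def)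
qed

text \<open>The slice over y collects limits of \<open>act (t n) z\<close> with z tending to y and n
  in D, so it may be larger than the closure of the points \<open>act (t n) y\<close>.\<close>

definition graph_closure :: "(int \<Rightarrow> 'g) \<Rightarrow> int set \<Rightarrow> ('a \<times> 'a) set"
  where "graph_closure t D =
    prod_topology X X closure_of {(y, act (t n) y) | y n. y \<in> topspace X \<and> n \<in> D}"

lemma graph_closure_mono: "D \<subseteq> E \<Longrightarrow> graph_closure t D \<subseteq> graph_closure t E"
  unfolding graph_closure_def by (intro closure_of_mono) blast

lemma invariant_graph_closure: "invariant_relation (graph_closure t D)"
  unfolding invariant_relation_def
proof (intro conjI allI impI)
  show "closedin (prod_topology X X) (graph_closure t D)"
    unfolding graph_closure_def by simp
  fix x y g assume xy: "(x, y) \<in> graph_closure t D"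
  let ?S = "{(y, act (t n) y) | y n. y \<in> topspace X \<and> n \<in> D}"
  let ?f = "\<lambda>p. (act g (fst p), act g (snd p))"
  have cont: "continuous_map (prod_topology X X) (prod_topology X X) ?f"
    using continuous_map_compose[OF continuous_map_fst continuous_act[of g]]
      continuous_map_compose[OF continuous_map_snd continuous_act[of g]]
    by (intro continuous_map_pairedI) (auto simp: o_def)
  have "?f (x, y) \<in> prod_topology X X closure_of (?f ` ?S)"
    using continuous_map_image_closure_subset[OF cont, of ?S] xy unfolding graph_closure_def by blast
  moreover have "?f ` ?S \<subseteq> ?S"
  proof
    fix p assume "p \<in> ?f ` ?S"
    then obtain z n where z: "z \<in> topspace X" "n \<in> D" "p = (act g z, act g (act (t n) z))" by auto
    then have "p = (act g z, act (t n) (act g z))"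
      by (simp add: act_add[symmetric] add.commute)
    then show "p \<in> ?S" using z act_closed by blast
  qed
  then have "prod_topology X X closure_of (?f ` ?S) \<subseteq> graph_closure t D"
    unfolding graph_closure_def by (rule closure_of_mono)
  ultimately show "(act g x, act g y) \<in> graph_closure t D" by auto
qed

lemma in_graph_closure_approx:
  assumes "(y, x) \<in> graph_closure t D" "openin X P" "y \<in> P" "openin X Q" "x \<in> Q"
  shows "\<exists>z\<in>P. \<exists>n\<in>D. act (t n) z \<in> Q"
proof -
  have "openin (prod_topology X X) (P \<times> Q)" using assms by (simp add: openin_prod_Times_iff)
  then have "\<exists>p. p \<in> {(y, act (t n) y) | y n. y \<in> topspace X \<and> n \<in> D} \<and> p \<in> P \<times> Q"
    using assms unfolding graph_closure_def in_closure_of by (metis (no_types, lifting) mem_Sigma_iff)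
  then show ?thesis by blast
qed

lemma graph_closure_transitive:
  assumes "transitive t" "x \<in> topspace X" "y \<in> topspace X"
  shows "(x, y) \<in> graph_closure t UNIV"
  unfolding graph_closure_def in_closure_of
proof (intro conjI allI impI)
  fix T assume T: "(x, y) \<in> T \<and> openin (prod_topology X X) T"
  then obtain P Q where PQ: "openin X P" "openin X Q" "x \<in> P" "y \<in> Q" "P \<times> Q \<subseteq> T"
    unfolding openin_prod_topology_alt by blast
  then have "P \<noteq> {}" "Q \<noteq> {}" by auto
  with PQ obtain n u where "u \<in> P" "act (t n) u \<in> Q"
    using assms(1) unfolding transitive_def by meson
  then show "\<exists>p. p \<in> {(y, act (t n) y) | y n. y \<in> topspace X \<and> n \<in> UNIV} \<and> p \<in> T"
    using PQ(5) openin_subset[OF PQ(1)] by blast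
qed (use assms in simp)

lemma graph_closure_disjoint:
  assumes "\<And>n u. \<lbrakk>n \<in> D; u \<in> U\<rbrakk> \<Longrightarrow> act (t n) u \<notin> V" "openin X U" "openin X V"
  shows "graph_closure t D \<inter> U \<times> V = {}"
proof -
  have False if "(y, x) \<in> graph_closure t D" "y \<in> U" "x \<in> V" for y x
    using in_graph_closure_approx[OF that(1) assms(2) that(2) assms(3) that(3)] assms(1) by blast
  then show ?thesis by auto
qed

text \<open>Were \<open>D\<close> disjoint from the return times, the slices of the graph closure over \<open>D\<close> would
  depend, up to content zero, only on the invariant_pseudometric they define; restricting \<open>D\<close> to the times
  at which \<open>t\<close> is close to a suitable \<open>g\<close> in it gives null slices, finitely many translates of
  which cover \<open>X\<close>.\<close>

lemma bohr_syndetic_meets_returns: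
  assumes t: "Modules.additive t" and trans: "transitive t"
    and U: "openin X U" "U \<noteq> {}" and V: "openin X V" "V \<noteq> {}"
    and D: "\<And>\<rho> a g e. \<lbrakk>invariant_pseudometric \<rho>; a \<in> topspace X; e > 0\<rbrakk> \<Longrightarrow>
      \<exists>M. finite M \<and> (\<forall>n. \<exists>m\<in>M. n - m \<in> D \<and> \<rho> (act (t (n - m)) a) (act g a) < e)"
  shows "\<exists>n\<in>D. \<exists>u\<in>U. act (t n) u \<in> V"
proof (rule ccontr)
  interpret t: Modules.additive t by (rule t)
  assume "\<not> (\<exists>n\<in>D. \<exists>u\<in>U. act (t n) u \<in> V)"
  then have WUV: "graph_closure t D \<inter> U \<times> V = {}"
    using U(1) V(1) by (intro graph_closure_disjoint) auto
  define W where "W = graph_closure t D"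
  have W: "invariant_relation W" unfolding W_def by (rule invariant_graph_closure)
  define \<rho> where "\<rho> = slice_distance W"
  have \<rho>: "invariant_pseudometric \<rho>" unfolding \<rho>_def by (rule pseudometric_slice_distance[OF W])
  \<comment> \<open>Near a, every point is at distance zero from a point of U, and slices over
    points of U miss V.\<close>
  obtain a e where a: "a \<in> U" "e > 0"
    "\<And>z. \<lbrakk>z \<in> topspace X; \<rho> a z < e\<rbrakk> \<Longrightarrow> \<exists>v\<in>U. \<rho> z v = 0"
    using pm_saturation_interior[OF \<rho> U] by metis
  have aX: "a \<in> topspace X" using a(1) openin_subset[OF U(1)] by blast
  obtain g where g: "act g a \<in> V" using orbit_meets_open[OF V aX] by blast
  then obtain N C where N: "openin X N" "closedin X C" "act g a \<in> N" "N \<subseteq> C" "C \<subseteq> V"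
    using closed_neighbourhood[OF V(1)] by metis
  \<comment> \<open>Choose h moving x close to g a. By commutativity and invariance h moves a by
    less than e/2 + e/2, so \<open>act h a\<close> is at distance zero from a point of U, whose
    slice misses V. Pulling back by h makes the slice over a null near x.\<close>
  have local_null: "\<exists>G. openin X G \<and> x \<in> G \<and> content (W `` {a} \<inter> G) = 0"
    if x: "x \<in> topspace X" "\<rho> x (act g a) < e/2" for x
  proof -
    let ?N = "N \<inter> {v \<in> topspace X. \<rho> (act g a) v < e/2}"
    have gaX: "act g a \<in> topspace X" by (rule act_closed[OF aX])
    have "openin X ?N" using N(1) openin_pm_ball[OF \<rho> gaX] by blast
    moreover have "act g a \<in> ?N" using N(3) gaX a(2) pm_refl[OF \<rho> gaX] by simp
    ultimately obtain h where h: "act h x \<in> ?N" using orbit_meets_open[of ?N x] x(1) by blast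
    have haX: "act h a \<in> topspace X" and hxX: "act h x \<in> topspace X"
      using act_closed aX x(1) by auto
    have "\<rho> a (act h a) = \<rho> (act g a) (act g (act h a))"
      using pm_act[OF \<rho> aX haX] by simp
    also have "\<dots> \<le> \<rho> (act g a) (act h x) + \<rho> (act h x) (act g (act h a))"
      by (intro pm_triangle[OF \<rho>] gaX hxX act_closed haX)
    also have "act g (act h a) = act h (act g a)"
      by (simp add: act_add[symmetric] aX add.commute)
    also have "\<rho> (act h x) (act h (act g a)) = \<rho> x (act g a)"
      by (rule pm_act[OF \<rho> x(1) gaX])
    finally have "\<rho> a (act h a) < e" using h x(2) by simp
    then obtain v where v: "v \<in> U" "\<rho> (act h a) v = 0" using a(3)[OF haX] by blast
    have vX: "v \<in> topspace X" using v(1) openin_subset[OF U(1)] by blast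
    have "W `` {v} \<inter> C = {}" using WUV v(1) N(5) unfolding W_def by blast
    then have "content (W `` {act h a} \<inter> C) = 0"
      using slice_null[OF W haX vX _ N(2)] v(2) unfolding \<rho>_def by blast
    moreover have "content (pre h (W `` {act h a} \<inter> C)) = content (W `` {act h a} \<inter> C)"
      using slice_subset[OF W] by (intro content_pre) auto
    moreover have "W `` {a} \<inter> pre h C = pre h (W `` {act h a} \<inter> C)"
    proof -
      have "pre h (W `` {act h a}) = W `` {a}"
        using slice_act[OF W haX, of "- h"] by (simp add: act_minus aX)
      then show ?thesis by (auto simp: pre_def)
    qed
    ultimately have 0: "content (W `` {a} \<inter> pre h C) = 0" by simp
    have "content (W `` {a} \<inter> pre h N) \<le> 0"
      using content_mono[of "W `` {a} \<inter> pre h C" "W `` {a} \<inter> pre h N"] N(4) 0 pre_subset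
      by (force simp: pre_def)
    moreover have "0 \<le> content (W `` {a} \<inter> pre h N)"
      using pre_subset by (intro content_nonneg) auto
    ultimately show ?thesis
      using openin_pre[OF N(1)] h x(1) by (intro exI[of _ "pre h N"]) (auto simp: pre_def)
  qed
  obtain M where M: "finite M"
    "\<And>n. \<exists>m\<in>M. n - m \<in> D \<and> \<rho> (act (t (n - m)) a) (act g a) < e/4"
    using D[OF \<rho> aX, of "e/4" g] a(2) by auto
  \<comment> \<open>The radius e/4, together with two approximation errors e/8 in
    \<open>near\<close>, stays within the e/2 that \<open>local_null\<close> tolerates.\<close>
  define D1 where "D1 = {n \<in> D. \<rho> (act (t n) a) (act g a) < e/4}"
  define R where "R = graph_closure t D1"
  have R: "invariant_relation R" unfolding R_def by (rule invariant_graph_closure)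
  have near: "\<rho> x (act g a) < e/2" if "(a, x) \<in> R" for x
  proof -
    have xX: "x \<in> topspace X" using relation_subset[OF R] that by auto
    let ?B = "\<lambda>x. {v \<in> topspace X. \<rho> x v < e/8}"
    have ball: "openin X (?B y)" "y \<in> ?B y" if "y \<in> topspace X" for y
      by (rule openin_pm_ball[OF \<rho> that]) (use pm_refl[OF \<rho> that] that a(2) in simp)
    have "\<exists>z\<in>?B a. \<exists>n\<in>D1. act (t n) z \<in> ?B x"
      using that unfolding R_def by (rule in_graph_closure_approx) (rule ball aX xX)+
    then obtain z n where z: "z \<in> ?B a" "n \<in> D1" "act (t n) z \<in> ?B x" by blast
    have zX: "z \<in> topspace X" "act (t n) z \<in> topspace X" "act g z \<in> topspace X" "act g a \<in> topspace X"
      using z act_closed aX by auto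
    have "\<rho> x (act g a) \<le> \<rho> x (act (t n) z) + \<rho> (act (t n) z) (act g a)"
      by (intro pm_triangle[OF \<rho>] xX zX)
    also have "\<rho> (act (t n) z) (act g a) \<le> \<rho> (act (t n) z) (act g z) + \<rho> (act g z) (act g a)"
      by (intro pm_triangle[OF \<rho>] zX)
    also have "\<rho> (act (t n) z) (act g z) = \<rho> (act (t n) a) (act g a)"
      by (rule pm_displacement[OF \<rho> zX(1) aX])
    also have "\<rho> (act g z) (act g a) = \<rho> a z"
      using pm_act[OF \<rho> zX(1) aX] pm_sym[OF \<rho> zX(1) aX] by simp
    finally show ?thesis using z by (simp add: D1_def)
  qed
  have "R \<subseteq> W" unfolding R_def W_def by (rule graph_closure_mono) (auto simp: D1_def)
  \<comment> \<open>The slice is compact and, by \<open>near\<close>, lies where the larger slice of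
    W is locally null.\<close>
  have "content (R `` {a}) = 0"
  proof -
    let ?\<G> = "{G. openin X G \<and> content (W `` {a} \<inter> G) = 0}"
    have "R `` {a} \<subseteq> \<Union>?\<G>" using local_null near slice_subset[OF R, of "{a}"] by blast
    then obtain \<F> where \<F>: "finite \<F>" "\<F> \<subseteq> ?\<G>" "R `` {a} \<subseteq> \<Union>\<F>"
      using compactinD[OF closedin_compact_space[OF compact closedin_slice[OF R aX]], of ?\<G>]
      by blast
    have "content (\<Union>((\<lambda>G. W `` {a} \<inter> G) ` \<F>)) = 0"
      using \<F>(1,2) slice_subset[OF W] by (intro content_null_Union) auto
    moreover have "R `` {a} \<subseteq> \<Union>((\<lambda>G. W `` {a} \<inter> G) ` \<F>)" using \<F>(3) \<open>R \<subseteq> W\<close> by blast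
    moreover have "\<Union>((\<lambda>G. W `` {a} \<inter> G) ` \<F>) \<subseteq> topspace X" using slice_subset[OF W] by blast
    ultimately have "content (R `` {a}) \<le> 0" using content_mono by metis
    then show ?thesis using content_nonneg[OF slice_subset[OF R], of "{a}"] by simp
  qed
  then have null: "content (pre (- t m) (R `` {a})) = 0" for m
    using content_pre[OF slice_subset[OF R]] by simp
  \<comment> \<open>R shifted by time m. Each n differs from a member of D1 by some m in M, so these
    finitely many closed sets contain all graphs and hence, by transitivity, all of X x X. Over a
    this covers X by null sets.\<close>
  define E where "E m = {p \<in> topspace (prod_topology X X). (fst p, act (- t m) (snd p)) \<in> R}" for m
  have clE: "closedin (prod_topology X X) (E m)" for m
    unfolding E_def
  proof (rule closedin_continuous_map_preimage[OF _ relation_closed[OF R]])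
    show "continuous_map (prod_topology X X) (prod_topology X X) (\<lambda>p. (fst p, act (- t m) (snd p)))"
      using continuous_map_compose[OF continuous_map_snd continuous_act[of "- t m"]]
      by (intro continuous_map_pairedI continuous_map_fst) (auto simp: o_def)
  qed
  have "{(y, act (t n) y) | y n. y \<in> topspace X \<and> n \<in> UNIV} \<subseteq> \<Union>(E ` M)"
  proof clarify
    fix y n assume y: "y \<in> topspace X"
    obtain m where m: "m \<in> M" "n - m \<in> D1" using M(2)[of n] by (auto simp: D1_def)
    have "(y, act (t (n - m)) y) \<in> R"
      unfolding R_def graph_closure_def
      using closure_of_subset[of "{(y, act (t n) y) | y n. y \<in> topspace X \<and> n \<in> D1}" "prod_topology X X"]
        y m(2) act_closed by auto
    moreover have "act (- t m) (act (t n) y) = act (t (n - m)) y"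
      by (simp add: act_add[symmetric] y t.diff)
    ultimately have "(y, act (t n) y) \<in> E m"
      using y by (simp add: E_def act_closed)
    then show "(y, act (t n) y) \<in> \<Union>(E ` M)" using m(1) by blast
  qed
  then have "graph_closure t UNIV \<subseteq> \<Union>(E ` M)"
    unfolding graph_closure_def using M(1) clE by (intro closure_of_minimal closedin_Union) auto
  then have cover: "topspace X \<subseteq> \<Union>((\<lambda>m. pre (- t m) (R `` {a})) ` M)"
    using graph_closure_transitive[OF trans aX] by (fastforce simp: E_def pre_def)
  have "content (\<Union>((\<lambda>m. pre (- t m) (R `` {a})) ` M)) = 0"
    using M(1) null pre_subset by (intro content_null_Union) auto
  moreover have "\<Union>((\<lambda>m. pre (- t m) (R `` {a})) ` M) = topspace X"
    using cover pre_subset by blast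
  ultimately show False using content_topspace by simp
qed

text \<open>Induction on the set J of coordinates already refined from the factor to X, with \<rho>
  arbitrary. Refining a coordinate j requires syndetic control over a pseudometric \<sigma> not
  known beforehand, and the induction hypothesis for the sum of \<rho> and \<sigma> provides
  it.\<close>

lemma bohr_dense_imp_prod_transitive:
  fixes t :: "'i \<Rightarrow> int \<Rightarrow> 'g"
  assumes "finite I" and t: "\<And>i. i \<in> I \<Longrightarrow> Modules.additive (t i)"
    and trans: "\<And>i. i \<in> I \<Longrightarrow> transitive (t i)" and bohr: "bohr_dense I t"
  shows "prod_transitive I (\<lambda>_. X) t"
proof -
  have "prod_transitive I (\<lambda>i. if i \<in> J then X else pm_topology \<rho>) t"
    if "finite J" "J \<subseteq> I" "invariant_pseudometric \<rho>" for J \<rho>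
    using that
  proof (induction J arbitrary: \<rho> rule: finite_induct)
    case empty
    note \<rho> = empty(2)
    show ?case
      unfolding prod_transitive_def
    proof (intro allI impI)
      fix U V :: "'i \<Rightarrow> 'a set"
      assume "\<forall>i\<in>I. openin (if i \<in> {} then X else pm_topology \<rho>) (U i) \<and> U i \<noteq> {} \<and>
        openin (if i \<in> {} then X else pm_topology \<rho>) (V i) \<and> V i \<noteq> {}"
      then have UV: "openin (pm_topology \<rho>) (U i)" "U i \<noteq> {}" "openin (pm_topology \<rho>) (V i)"
        "V i \<noteq> {}" if "i \<in> I" for i using that by auto
      have "\<exists>x g e. x \<in> U i \<and> x \<in> topspace X \<and> e > 0 \<and>
          (\<forall>y\<in>topspace X. \<rho> (act g x) y < e \<longrightarrow> y \<in> V i)" if i: "i \<in> I" for i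
      proof -
        obtain x where x: "x \<in> U i" "x \<in> topspace X"
          using UV(1,2)[OF i] unfolding openin_pm_topology by blast
        obtain g where g: "act g x \<in> V i"
          using orbit_meets_open[OF openin_pm_topology_imp[OF \<rho> UV(3)[OF i]] UV(4)[OF i] x(2)] by blast
        then obtain e where "e > 0" "\<forall>y\<in>topspace X. \<rho> (act g x) y < e \<longrightarrow> y \<in> V i"
          using UV(3)[OF i] unfolding openin_pm_topology by blast
        with x show ?thesis by blast
      qed
      then obtain x g e where xge: "\<And>i. i \<in> I \<Longrightarrow> x i \<in> U i \<and> x i \<in> topspace X \<and> e i > 0 \<and>
          (\<forall>y\<in>topspace X. \<rho> (act (g i) (x i)) y < e i \<longrightarrow> y \<in> V i)" by metis
      show "\<exists>n. \<forall>i\<in>I. \<exists>u\<in>U i. act (t i n) u \<in> V i"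
      proof (cases "I = {}")
        case False
        then obtain j where j: "j \<in> I" by blast
        define d where "d = Min (e ` I)"
        have d: "d > 0" "\<And>i. i \<in> I \<Longrightarrow> d \<le> e i"
          using \<open>finite I\<close> False xge unfolding d_def by auto
        have xj: "x j \<in> topspace X" using xge j by blast
        \<comment> \<open>One base point serves all coordinates: by constant displacement, closeness
          of t_i n to g_i at \<open>x j\<close> is closeness at \<open>x i\<close>.\<close>
        obtain n where n: "\<And>i. i \<in> I \<Longrightarrow> \<rho> (act (t i n) (x j)) (act (g i) (x j)) < d"
          using bohr_denseD[OF bohr xj d(1) \<rho>] by metis
        have "act (t i n) (x i) \<in> V i" if i: "i \<in> I" for i
        proof -
          have xi: "x i \<in> topspace X" using xge i by blast
          have "\<rho> (act (g i) (x i)) (act (t i n) (x i)) = \<rho> (act (t i n) (x j)) (act (g i) (x j))"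
            using pm_displacement[OF \<rho> xi xj] pm_sym[OF \<rho>] act_closed xi by metis
          also have "\<dots> < e i" using n[OF i] d(2)[OF i] by simp
          finally show ?thesis using xge[OF i] act_closed xi by blast
        qed
        then show ?thesis using xge by blast
      qed simp
    qed
  next
    case (insert j J)
    note \<rho> = insert.prems(2)
    have j: "j \<in> I" "J \<subseteq> I" using insert.prems by auto
    show ?case
      unfolding prod_transitive_def
    proof (intro allI impI)
      fix U V :: "'i \<Rightarrow> 'a set"
      assume UV: "\<forall>i\<in>I. openin (if i \<in> insert j J then X else pm_topology \<rho>) (U i) \<and> U i \<noteq> {} \<and>
        openin (if i \<in> insert j J then X else pm_topology \<rho>) (V i) \<and> V i \<noteq> {}"
      \<comment> \<open>The times that are good for all coordinates other than j; coordinate j must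
        be matched with one of them.\<close>
      let ?D = "{n. \<forall>i\<in>I - {j}. \<exists>u\<in>U i. act (t i n) u \<in> V i}"
      have "\<exists>n\<in>?D. \<exists>u\<in>U j. act (t j n) u \<in> V j"
      proof (rule bohr_syndetic_meets_returns[OF t[OF j(1)] trans[OF j(1)]])
        fix \<sigma> a g and e :: real
        assume \<sigma>: "invariant_pseudometric \<sigma>" and a: "a \<in> topspace X" and e: "e > 0"
        let ?\<tau> = "\<lambda>x y. \<rho> x y + \<sigma> x y"
        let ?Y = "\<lambda>i. if i \<in> J then X else pm_topology ?\<tau>"
        let ?B = "\<lambda>y. {z \<in> topspace X. \<sigma> y z < e/2}"
        have \<tau>: "invariant_pseudometric ?\<tau>" by (rule pseudometric_add[OF \<rho> \<sigma>])
        have ga: "act g a \<in> topspace X" by (rule act_closed[OF a])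
        have ball: "openin (pm_topology ?\<tau>) (?B y)" if "y \<in> topspace X" for y
        proof -
          have "openin (pm_topology (\<lambda>x y. \<sigma> x y + \<rho> x y)) (?B y)"
            by (rule pm_topology_mono[OF \<rho> openin_pm_topology_ball[OF \<sigma> that]])
          then show ?thesis by (simp only: add.commute)
        qed
        have open': "openin (?Y i) ((A(j := ?B y)) i)"
          if "i \<in> I" "y \<in> topspace X" "\<forall>i\<in>I. openin (if i \<in> insert j J then X else pm_topology \<rho>) (A i)"
          for i y and A :: "'i \<Rightarrow> 'a set"
        proof (cases "i = j")
          case True
          then show ?thesis using ball[OF that(2)] insert.hyps by simp
        next
          case False
          then show ?thesis using that(1,3) pm_topology_mono[OF \<sigma>, of \<rho> "A i"] by auto
        qed
        have ne: "?B y \<noteq> {}" if "y \<in> topspace X" for y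
          using that e pm_refl[OF \<sigma> that] by force
        \<comment> \<open>In coordinate j the \<sigma>-balls around a and g a express that t_j is
          close to g at a; the other coordinates keep U and V, so the times found also belong to
          \<open>?D\<close>.\<close>
        obtain M where M: "finite M"
          "\<And>n. \<exists>m\<in>M. \<forall>i\<in>I. \<exists>u\<in>(U(j := ?B a)) i. act (t i (n - m)) u \<in> (V(j := ?B (act g a))) i"
        proof (rule syndetic_returns[of I ?Y t "U(j := ?B a)" "V(j := ?B (act g a))"])
          show "prod_transitive I ?Y t" by (rule insert.IH[OF j(2) \<tau>])
          show "invariant_coarsening (?Y i)" for i using coarse_self coarse_pm_topology[OF \<tau>] by simp
        qed (use \<open>finite I\<close> t open' UV ne a ga in auto)
        have "\<exists>m\<in>M. n - m \<in> ?D \<and> \<sigma> (act (t j (n - m)) a) (act g a) < e" for n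
        proof -
          obtain m where m: "m \<in> M"
            "\<forall>i\<in>I. \<exists>u\<in>(U(j := ?B a)) i. act (t i (n - m)) u \<in> (V(j := ?B (act g a))) i"
            using M(2)[of n] by blast
          have "n - m \<in> ?D" using m(2) by (auto split: if_splits)
          obtain u where u: "u \<in> topspace X" "\<sigma> a u < e/2" "\<sigma> (act g a) (act (t j (n - m)) u) < e/2"
            using bspec[OF m(2) j(1)] by auto
          have "\<sigma> (act (t j (n - m)) a) (act g a)
              \<le> \<sigma> (act (t j (n - m)) a) (act (t j (n - m)) u) + \<sigma> (act (t j (n - m)) u) (act g a)"
            by (intro pm_triangle[OF \<sigma>] act_closed a u)
          also have "\<dots> = \<sigma> a u + \<sigma> (act g a) (act (t j (n - m)) u)"
            using pm_act[OF \<sigma> a u(1)] pm_sym[OF \<sigma> ga act_closed[OF u(1)]] by simp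
          finally show ?thesis using u m(1) \<open>n - m \<in> ?D\<close> by force
        qed
        then show "\<exists>M. finite M \<and> (\<forall>n. \<exists>m\<in>M. n - m \<in> ?D \<and> \<sigma> (act (t j (n - m)) a) (act g a) < e)"
          using M(1) by blast
      qed (use UV j(1) in auto)
      then show "\<exists>n. \<forall>i\<in>I. \<exists>u\<in>U i. act (t i n) u \<in> V i" by blast
    qed
  qed
  from this[of I "\<lambda>_ _. 0"] have "prod_transitive I (\<lambda>i. if i \<in> I then X else pm_topology (\<lambda>_ _. 0)) t"
    using \<open>finite I\<close> by (auto simp: invariant_pseudometric_def)
  then show ?thesis by (simp add: prod_transitive_def cong: ball_cong)
qed

text \<open>The hypotheses are inherited by the quotients by t_j: differences of the quotients are
  again differences of the t_i, and \<open>bohr_dense_diff\<close> handles Bohr density.\<close>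

lemma joint_visit:
  fixes t :: "'i \<Rightarrow> int \<Rightarrow> 'g"
  assumes "finite I" "\<And>i. i \<in> I \<Longrightarrow> Modules.additive (t i)" "\<And>i. i \<in> I \<Longrightarrow> transitive (t i)"
    "\<And>i j. \<lbrakk>i \<in> I; j \<in> I; i \<noteq> j\<rbrakk> \<Longrightarrow> transitive (\<lambda>n. t j n - t i n)" "bohr_dense I t"
    "openin X W" "W \<noteq> {}" "\<And>i. i \<in> I \<Longrightarrow> openin X (V i) \<and> V i \<noteq> {}"
  shows "\<exists>x\<in>W. \<exists>n. \<forall>i\<in>I. act (t i n) x \<in> V i"
  using assms
proof (induction I arbitrary: t W V rule: finite_induct)
  case (insert j I)
  note t = insert.prems(1) and diff = insert.prems(3) and bohr = insert.prems(4)
  let ?s = "\<lambda>i n. t i n - t j n"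
  have prod: "prod_transitive (insert j I) (\<lambda>_. X) t"
    using insert.hyps insert.prems by (intro bohr_dense_imp_prod_transitive) auto
  have ij: "i \<noteq> j" if "i \<in> I" for i using that insert.hyps by blast
  have s1: "Modules.additive (?s i)" if "i \<in> I" for i
  proof -
    interpret ti: Modules.additive "t i" using t that by blast
    interpret tj: Modules.additive "t j" using t by blast
    show ?thesis by unfold_locales (simp add: ti.add tj.add)
  qed
  have s2: "transitive (?s i)" if "i \<in> I" for i
    using diff[of j i] that ij by blast
  have s3: "transitive (\<lambda>n. ?s k n - ?s i n)" if "i \<in> I" "k \<in> I" "i \<noteq> k" for i k
    using diff[of i k] that by simp
  have s4: "bohr_dense I ?s"
    using bohr_dense_diff[OF bohr, of j] insert.hyps by simp
  have visit: "\<exists>x\<in>topspace X. \<exists>n. \<forall>i\<in>insert j I. act (t i n) x \<in> V i"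
    if V: "\<And>i. i \<in> insert j I \<Longrightarrow> openin X (V i) \<and> V i \<noteq> {}" for V
  proof -
    \<comment> \<open>For the quotients, V j takes the place of W. Going back from y by t_j n gives
      a point that visits V j at time n by returning to y, and V i because there t_i n acts as the
      quotient does on y.\<close>
    have "\<exists>y\<in>V j. \<exists>n. \<forall>i\<in>I. act (?s i n) y \<in> V i"
      using V by (intro insert.IH s1 s2 s3 s4) auto
    then obtain y n where y: "y \<in> V j" "\<And>i. i \<in> I \<Longrightarrow> act (?s i n) y \<in> V i" by blast
    have yX: "y \<in> topspace X" using V[of j] y(1) openin_subset by blast
    have "act (t i n) (act (- t j n) y) \<in> V i" if "i \<in> insert j I" for i
      using that y yX by (auto simp: act_minus' act_zero act_add[symmetric])
    then show ?thesis using act_closed[OF yX] by blast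
  qed
  show ?case
    by (rule joint_visit_from_open[OF prod t visit insert.prems(5,6,7)])
qed auto

end

section \<open>Existence of invariant means\<close>

text \<open>Tychonoff for a cube. The index set may be uncountable, in the application all sets of
  points, so convergence is along a filter finer than the sequence instead of along a
  subsequence.\<close>

lemma cluster_point_tendsto:
  fixes a :: "nat \<Rightarrow> 'i \<Rightarrow> real"
  assumes "\<And>n i. a n i \<in> {0..1}"
  obtains \<nu> G where "\<And>i. \<nu> i \<in> {0..1}" "G \<noteq> bot" "G \<le> filtermap a sequentially"
    "\<And>i. ((\<lambda>\<phi>. \<phi> i) \<longlongrightarrow> \<nu> i) G"
proof -
  have "compactin (product_topology (\<lambda>_::'i. euclideanreal) UNIV) (PiE UNIV (\<lambda>_. {0..1}))"
    unfolding compactin_PiE by simp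
  then have "compact (PiE UNIV (\<lambda>_::'i. {0..1::real}))"
    by (simp add: euclidean_product_topology)
  moreover have "eventually (\<lambda>\<phi>. \<phi> \<in> PiE UNIV (\<lambda>_. {0..1})) (filtermap a sequentially)"
    unfolding eventually_filtermap using assms by (intro always_eventually allI) (auto simp: PiE_iff)
  moreover have "filtermap a sequentially \<noteq> bot" by (simp add: filtermap_bot_iff)
  ultimately obtain \<nu> where \<nu>: "\<nu> \<in> PiE UNIV (\<lambda>_. {0..1})" "inf (nhds \<nu>) (filtermap a sequentially) \<noteq> bot"
    unfolding compact_filter by blast
  have "((\<lambda>\<phi>. \<phi> i) \<longlongrightarrow> \<nu> i) (inf (nhds \<nu>) (filtermap a sequentially))" for i
  proof (rule filterlim_mono[OF _ order_refl inf_le1])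
    show "((\<lambda>\<phi>. \<phi> i) \<longlongrightarrow> \<nu> i) (nhds \<nu>)"
    proof (rule topological_tendstoI)
      fix T assume "open T" "\<nu> i \<in> T"
      then have "open ((\<lambda>\<phi>::'i \<Rightarrow> real. \<phi> i) -` T)" "\<nu> \<in> (\<lambda>\<phi>. \<phi> i) -` T"
        by (auto intro: open_vimage continuous_on_product_coordinates)
      then show "\<forall>\<^sub>F \<phi> in nhds \<nu>. \<phi> i \<in> T" unfolding eventually_nhds by blast
    qed
  qed
  moreover have "\<nu> i \<in> {0..1}" for i using \<nu>(1) by (rule PiE_mem) simp
  ultimately show ?thesis
    using that[of \<nu> "inf (nhds \<nu>) (filtermap a sequentially)"] \<nu>(2) by simp
qed

lemma mean_on_bounds: "\<lbrakk>mean_on S \<mu>; A \<subseteq> S\<rbrakk> \<Longrightarrow> \<mu> A \<in> {0..1}"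
  using mean_on_mono[of S \<mu> S A] by (auto simp: mean_on_def)

text \<open>A finitely additive Markov--Kakutani theorem: average over the powers of each map in turn.\<close>

lemma commuting_maps_invariant_mean:
  fixes F :: "('a \<Rightarrow> 'a) set"
  assumes "finite F" "S \<noteq> {}" "\<And>f x. \<lbrakk>f \<in> F; x \<in> S\<rbrakk> \<Longrightarrow> f x \<in> S"
    and "\<And>f g x. \<lbrakk>f \<in> F; g \<in> F; x \<in> S\<rbrakk> \<Longrightarrow> f (g x) = g (f x)"
  shows "\<exists>\<mu>. mean_on S \<mu> \<and> (\<forall>f\<in>F. \<forall>A. A \<subseteq> S \<longrightarrow> \<mu> {x \<in> S. f x \<in> A} = \<mu> A)"
  using assms
proof (induction F rule: finite_induct)
  case empty
  then obtain x where "x \<in> S" by blast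
  then have "mean_on S (\<lambda>A. if x \<in> A then 1 else 0)" by (auto simp: mean_on_def)
  then show ?case by blast
next
  case (insert f F)
  have "\<exists>\<mu>. mean_on S \<mu> \<and> (\<forall>g\<in>F. \<forall>A. A \<subseteq> S \<longrightarrow> \<mu> {x \<in> S. g x \<in> A} = \<mu> A)"
    by (rule insert.IH) (simp_all add: insert.prems)
  then obtain \<mu> where \<mu>: "mean_on S \<mu>"
    and inv: "\<And>g A. \<lbrakk>g \<in> F; A \<subseteq> S\<rbrakk> \<Longrightarrow> \<mu> {x \<in> S. g x \<in> A} = \<mu> A" by blast
  have iter: "(f ^^ n) x \<in> S" if "x \<in> S" for n x
    using that insert.prems(2) by (induction n) auto
  have commute: "(f ^^ n) (g x) = g ((f ^^ n) x)" if "g \<in> F" "x \<in> S" for n g x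
    using that insert.prems(3)[of f g] iter by (induction n) auto
  define p where "p n A = {x \<in> S. (f ^^ n) x \<in> A}" for n A
  have p: "p n A \<subseteq> S" for n A by (auto simp: p_def)
  \<comment> \<open>Averages of the images of \<mu> under powers of f; taking \<open>Suc N\<close>
    of them keeps the denominator nonzero.\<close>
  define a where "a N A = (\<Sum>n<Suc N. \<mu> (p n A)) / real (Suc N)" for N A
  have "a N A \<in> {0..1}" for N A
  proof -
    have "(\<Sum>n<Suc N. \<mu> (p n A)) \<in> {0..real (Suc N)}"
      using sum_bounded_above[of "{..<Suc N}" "\<lambda>n. \<mu> (p n A)" 1] mean_on_bounds[OF \<mu> p]
      by (auto intro!: sum_nonneg simp del: sum.lessThan_Suc)
    then show ?thesis by (simp add: a_def field_simps)
  qed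
  then obtain \<nu> G where \<nu>: "\<And>A. \<nu> A \<in> {0..1}" and G: "G \<noteq> bot" "G \<le> filtermap a sequentially"
    and lim: "\<And>A. ((\<lambda>\<phi>. \<phi> A) \<longlongrightarrow> \<nu> A) G"
    using cluster_point_tendsto[of a] by blast
  \<comment> \<open>G is finer than the sequence, so a limit along the sequence is the limit along
    G. Each required identity for \<nu> is read off in this way.\<close>
  have transfer: "c = l" if "(\<lambda>N. h (a N)) \<longlonglongrightarrow> l" "(h \<longlongrightarrow> c) G" for h :: "('a set \<Rightarrow> real) \<Rightarrow> real" and c l
  proof -
    have "(h \<longlongrightarrow> l) (filtermap a sequentially)" using that(1) by (simp add: filterlim_filtermap)
    then have "(h \<longlongrightarrow> l) G" by (rule filterlim_mono[OF _ order_refl G(2)])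
    then show ?thesis using tendsto_unique[OF G(1) that(2)] by blast
  qed
  have "\<nu> S = 1"
  proof (rule transfer[OF _ lim])
    have "p n S = S" for n using iter by (auto simp: p_def)
    then have "a N S = 1" for N using \<mu> by (simp add: a_def mean_on_def del: sum.lessThan_Suc)
    then show "(\<lambda>N. a N S) \<longlonglongrightarrow> 1" by simp
  qed
  moreover have "\<nu> (A \<union> B) = \<nu> A + \<nu> B" if "A \<subseteq> S" "B \<subseteq> S" "A \<inter> B = {}" for A B
  proof -
    have "\<mu> (p n (A \<union> B)) = \<mu> (p n A) + \<mu> (p n B)" for n
    proof -
      have "p n (A \<union> B) = p n A \<union> p n B" "p n A \<inter> p n B = {}" using that(3) by (auto simp: p_def)
      then show ?thesis using mean_on_add[OF \<mu> p p] by metis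
    qed
    then have "a N (A \<union> B) - (a N A + a N B) = 0" for N
      by (simp add: a_def sum.distrib add_divide_distrib del: sum.lessThan_Suc)
    then have "\<nu> (A \<union> B) - (\<nu> A + \<nu> B) = 0"
      by (intro transfer[where h = "\<lambda>\<phi>. \<phi> (A \<union> B) - (\<phi> A + \<phi> B)"] tendsto_intros lim) simp
    then show ?thesis by simp
  qed
  ultimately have "mean_on S \<nu>" using \<nu> by (simp add: mean_on_def)
  moreover have "\<nu> {x \<in> S. g x \<in> A} = \<nu> A" if "g \<in> F" "A \<subseteq> S" for g A
  proof -
    \<comment> \<open>Since f and g commute, the preimage under g passes through the powers of f,
      and each average inherits invariance under g from \<mu>.\<close>
    have "p n {x \<in> S. g x \<in> A} = {x \<in> S. g x \<in> p n A}" for n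
      using commute[OF that(1)] iter insert.prems(2)[of g] that(1) by (auto simp: p_def)
    then have "a N {x \<in> S. g x \<in> A} - a N A = 0" for N
      using inv[OF that(1) p] by (simp add: a_def del: sum.lessThan_Suc)
    then have "\<nu> {x \<in> S. g x \<in> A} - \<nu> A = 0"
      by (intro transfer[where h = "\<lambda>\<phi>. \<phi> {x \<in> S. g x \<in> A} - \<phi> A"] tendsto_intros lim) simp
    then show ?thesis by simp
  qed
  moreover have "\<nu> {x \<in> S. f x \<in> A} = \<nu> A" if "A \<subseteq> S" for A
  proof -
    have "p n {x \<in> S. f x \<in> A} = p (Suc n) A" for n
      using iter by (auto simp: p_def)
    \<comment> \<open>Telescoping leaves two end terms, both in the unit interval, so the defect of
      invariance under f is at most 1/(N+1).\<close>
    then have diff: "a N {x \<in> S. f x \<in> A} - a N A = (\<mu> (p (Suc N) A) - \<mu> (p 0 A)) / real (Suc N)" for N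
      using sum_lessThan_telescope[of "\<lambda>n. \<mu> (p n A)" "Suc N"]
      by (simp add: a_def sum_subtractf flip: diff_divide_distrib del: sum.lessThan_Suc)
    have "(\<lambda>N. a N {x \<in> S. f x \<in> A} - a N A) \<longlonglongrightarrow> 0"
    proof (rule Lim_null_comparison[OF _ LIMSEQ_inverse_real_of_nat])
      have "\<bar>\<mu> (p (Suc N) A) - \<mu> (p 0 A)\<bar> \<le> 1" for N
        using mean_on_bounds[OF \<mu> p, of "Suc N" A] mean_on_bounds[OF \<mu> p, of 0 A] by auto
      then show "\<forall>\<^sub>F N in sequentially. norm (a N {x \<in> S. f x \<in> A} - a N A) \<le> inverse (real (Suc N))"
        unfolding diff by (intro always_eventually allI) (simp add: inverse_eq_divide divide_right_mono)
    qed
    then have "\<nu> {x \<in> S. f x \<in> A} - \<nu> A = 0"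
      by (intro transfer[where h = "\<lambda>\<phi>. \<phi> {x \<in> S. f x \<in> A} - \<phi> A"] tendsto_intros lim) simp
    then show ?thesis by simp
  qed
  ultimately show ?case by blast
qed

section \<open>Generic points and dense orbits\<close>

context minimal_abelian_action
begin

text \<open>Baire category: a countable base yields countably many boxes, and the points visiting a
  given box at some time form an open set, dense by \<open>visit\<close>.\<close>

lemma generic_visits:
  fixes t :: "'i \<Rightarrow> int \<Rightarrow> 'g"
  assumes "second_countable X" "finite I"
    and visit: "\<And>W V. \<lbrakk>openin X W; W \<noteq> {}; \<And>i. i \<in> I \<Longrightarrow> openin X (V i) \<and> V i \<noteq> {}\<rbrakk> \<Longrightarrow>
      \<exists>x\<in>W. \<exists>n. \<forall>i\<in>I. act (t i n) x \<in> V i"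
  shows "\<exists>X0. gdelta_in X X0 \<and> X closure_of X0 = topspace X \<and>
    (\<forall>x\<in>X0. \<forall>V. (\<forall>i\<in>I. openin X (V i) \<and> V i \<noteq> {}) \<longrightarrow> (\<exists>n. \<forall>i\<in>I. act (t i n) x \<in> V i))"
proof -
  obtain \<B> where \<B>: "countable \<B>" "\<And>V. V \<in> \<B> \<Longrightarrow> openin X V"
    "\<And>U x. \<lbrakk>openin X U; x \<in> U\<rbrakk> \<Longrightarrow> \<exists>V\<in>\<B>. x \<in> V \<and> V \<subseteq> U"
    using assms(1) unfolding second_countable_def by metis
  define H where "H V = {x \<in> topspace X. \<exists>n. \<forall>i\<in>I. act (t i n) x \<in> V i}" for V
  define \<P> where "\<P> = Pi\<^sub>E I (\<lambda>_. \<B> - {{}})"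
  have \<P>: "openin X (V i) \<and> V i \<noteq> {}" if "V \<in> \<P>" "i \<in> I" for V i
    using PiE_mem[OF that(1)[unfolded \<P>_def] that(2)] \<B>(2) by blast
  have cnt: "countable \<P>" unfolding \<P>_def using assms(2) \<B>(1) by (intro countable_PiE) auto
  have op: "openin X (H V)" if "V \<in> \<P>" for V
  proof -
    have "H V = (\<Union>n. topspace X \<inter> (\<Inter>i\<in>I. pre (t i n) (V i)))"
      by (auto simp: H_def pre_def)
    also have "openin X \<dots>"
    proof (intro openin_Union ballI)
      fix S assume "S \<in> range (\<lambda>n. topspace X \<inter> (\<Inter>i\<in>I. pre (t i n) (V i)))"
      then obtain n where S: "S = topspace X \<inter> (\<Inter>i\<in>I. pre (t i n) (V i))" by blast
      show "openin X S"
        unfolding S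
      proof (cases "I = {}")
        case False
        then have "openin X (\<Inter>i\<in>I. pre (t i n) (V i))"
          using \<P>[OF that] assms(2) openin_pre by (intro openin_INT2) auto
        then show "openin X (topspace X \<inter> (\<Inter>i\<in>I. pre (t i n) (V i)))" by blast
      qed simp
    qed
    finally show ?thesis .
  qed
  have dense: "X closure_of H V = topspace X" if VP: "V \<in> \<P>" for V
    unfolding dense_intersects_open
  proof (intro allI impI)
    fix W assume W: "openin X W \<and> W \<noteq> {}"
    then obtain x where "x \<in> W" "\<exists>n. \<forall>i\<in>I. act (t i n) x \<in> V i"
      using visit[of W V] \<P>[OF VP] by blast
    then show "H V \<inter> W \<noteq> {}" using W openin_subset by (fastforce simp: H_def)
  qed
  \<comment> \<open>Inserting the whole space keeps the intersection inside X even when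
    \<open>\<P>\<close> is empty.\<close>
  let ?\<H> = "insert (topspace X) (H ` \<P>)"
  show ?thesis
  proof (intro exI[of _ "\<Inter>?\<H>"] conjI ballI allI impI)
    show "gdelta_in X (\<Inter>?\<H>)"
      using cnt op by (intro gdelta_in_Inter) (auto intro: open_imp_gdelta_in)
    show "X closure_of \<Inter>?\<H> = topspace X"
    proof (rule Baire_category)
      have "locally_compact_space X"
        by (rule compact_imp_locally_compact_space[OF compact])
      then show "completely_metrizable_space X \<or> locally_compact_space X \<and> regular_space X"
        using compact_Hausdorff_imp_regular_space[OF compact Hausdorff] by blast
    qed (use cnt op dense in auto)
    fix x V assume x: "x \<in> \<Inter>?\<H>" and "\<forall>i\<in>I. openin X (V i) \<and> V i \<noteq> {}"
    then have V: "openin X (V i) \<and> V i \<noteq> {}" if "i \<in> I" for i using that by blast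
    have "\<exists>B. B \<in> \<B> - {{}} \<and> B \<subseteq> V i" if i: "i \<in> I" for i
    proof -
      obtain v where "v \<in> V i" using V[OF i] by blast
      then show ?thesis using \<B>(3)[of "V i" v] V[OF i] by blast
    qed
    then obtain B where B: "\<And>i. i \<in> I \<Longrightarrow> B i \<in> \<B> - {{}} \<and> B i \<subseteq> V i" by metis
    then have "restrict B I \<in> \<P>" by (auto simp: \<P>_def)
    then have "x \<in> H (restrict B I)" using x by blast
    then show "\<exists>n. \<forall>i\<in>I. act (t i n) x \<in> V i" using B by (fastforce simp: H_def)
  qed
qed

text \<open>Forward: a generic point for a single coordinate, indexed by \<open>()\<close>.
  Backward: if the orbit is in U at time a and in V at time b, then time b - a, of either sign,
  leads from U to V.\<close>

lemma transitive_iff_dense_orbit: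
  assumes "second_countable X" "topspace X \<noteq> {}" and t: "Modules.additive t"
  shows "transitive t \<longleftrightarrow> (\<exists>z\<in>topspace X. X closure_of {act (t n) z | n. True} = topspace X)"
proof
  assume trans: "transitive t"
  have "\<exists>X0. gdelta_in X X0 \<and> X closure_of X0 = topspace X \<and> (\<forall>x\<in>X0. \<forall>V.
      (\<forall>i\<in>{()}. openin X (V i) \<and> V i \<noteq> {}) \<longrightarrow> (\<exists>n. \<forall>i\<in>{()}. act ((\<lambda>_. t) i n) x \<in> V i))"
    using trans unfolding transitive_def by (intro generic_visits assms(1)) auto
  then obtain X0 where X0: "gdelta_in X X0" "X closure_of X0 = topspace X" "\<forall>x\<in>X0. \<forall>V.
      (\<forall>i\<in>{()}. openin X (V i) \<and> V i \<noteq> {}) \<longrightarrow> (\<exists>n. \<forall>i\<in>{()}. act ((\<lambda>_. t) i n) x \<in> V i)"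
    by (elim exE conjE) (rule that)
  obtain x where x: "x \<in> X0" using X0(2) assms(2) by fastforce
  have "X closure_of {act (t n) x | n. True} = topspace X"
    unfolding dense_intersects_open
  proof (intro allI impI)
    fix T assume "openin X T \<and> T \<noteq> {}"
    then obtain n where "act (t n) x \<in> T" using bspec[OF X0(3) x, THEN spec, of "\<lambda>_. T"] by auto
    then show "{act (t n) x | n. True} \<inter> T \<noteq> {}" by blast
  qed
  moreover have "x \<in> topspace X" using x X0(1) by (auto simp: gdelta_in_alt)
  ultimately show "\<exists>z\<in>topspace X. X closure_of {act (t n) z | n. True} = topspace X" by blast
next
  interpret t: Modules.additive t by (rule t)
  assume "\<exists>z\<in>topspace X. X closure_of {act (t n) z | n. True} = topspace X"
  then obtain z where z: "z \<in> topspace X" "X closure_of {act (t n) z | n. True} = topspace X" by blast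
  show "transitive t"
    unfolding transitive_def
  proof (intro allI impI)
    fix U V assume UV: "openin X U \<and> U \<noteq> {} \<and> openin X V \<and> V \<noteq> {}"
    have visit: "\<exists>n. act (t n) z \<in> T" if "openin X T" "T \<noteq> {}" for T
      using z(2)[unfolded dense_intersects_open, rule_format, of T] that by blast
    obtain a b where ab: "act (t a) z \<in> U" "act (t b) z \<in> V"
      using visit[of U] visit[of V] UV by blast
    have "act (t (b - a)) (act (t a) z) = act (t b) z"
      by (simp add: act_add[symmetric] z(1) t.diff)
    then show "\<exists>n. \<exists>u\<in>U. act (t n) u \<in> V" using ab by metis
  qed
qed

text \<open>Boxes form a base of the finite product. The point z is general in order to cover
  diagonal points as well as a transitive point of the product map.\<close>

lemma power_orbit_dense_iff:
  fixes t :: "'i \<Rightarrow> int \<Rightarrow> 'g"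
  assumes "finite I" "z \<in> topspace (product_topology (\<lambda>_. X) I)"
  shows "product_topology (\<lambda>_. X) I closure_of {(\<lambda>i\<in>I. act (t i n) (z i)) | n. True} =
      topspace (product_topology (\<lambda>_. X) I) \<longleftrightarrow>
    (\<forall>V. (\<forall>i\<in>I. openin X (V i) \<and> V i \<noteq> {}) \<longrightarrow> (\<exists>n. \<forall>i\<in>I. act (t i n) (z i) \<in> V i))"
  (is "?P closure_of ?O = _ \<longleftrightarrow> _")
proof
  assume "?P closure_of ?O = topspace ?P"
  then have meets: "?O \<inter> T \<noteq> {}" if "openin ?P T" "T \<noteq> {}" for T
    using that unfolding dense_intersects_open by blast
  show "\<forall>V. (\<forall>i\<in>I. openin X (V i) \<and> V i \<noteq> {}) \<longrightarrow> (\<exists>n. \<forall>i\<in>I. act (t i n) (z i) \<in> V i)"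
  proof (intro allI impI)
    fix V assume V: "\<forall>i\<in>I. openin X (V i) \<and> V i \<noteq> {}"
    have "openin ?P (Pi\<^sub>E I V)" using assms(1) V by (simp add: openin_PiE_gen)
    moreover have "Pi\<^sub>E I V \<noteq> {}" using V by (simp add: PiE_eq_empty_iff)
    ultimately obtain n where "(\<lambda>i\<in>I. act (t i n) (z i)) \<in> Pi\<^sub>E I V" using meets by blast
    then show "\<exists>n. \<forall>i\<in>I. act (t i n) (z i) \<in> V i" by (auto simp: PiE_iff)
  qed
next
  assume visit: "\<forall>V. (\<forall>i\<in>I. openin X (V i) \<and> V i \<noteq> {}) \<longrightarrow> (\<exists>n. \<forall>i\<in>I. act (t i n) (z i) \<in> V i)"
  show "?P closure_of ?O = topspace ?P"
    unfolding dense_intersects_open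
  proof (intro allI impI)
    fix T assume T: "openin ?P T \<and> T \<noteq> {}"
    then obtain y where "y \<in> T" by blast
    then obtain V where V: "\<forall>i\<in>I. openin X (V i)" "y \<in> Pi\<^sub>E I V" "Pi\<^sub>E I V \<subseteq> T"
      using T unfolding openin_product_topology_alt by meson
    have "\<forall>i\<in>I. openin X (V i) \<and> V i \<noteq> {}" using V(1,2) by (auto simp: PiE_iff)
    then obtain n where "\<forall>i\<in>I. act (t i n) (z i) \<in> V i" using visit by blast
    then have "(\<lambda>i\<in>I. act (t i n) (z i)) \<in> Pi\<^sub>E I V" by auto
    then show "?O \<inter> T \<noteq> {}" using V(3) by blast
  qed
qed

lemma power_orbit_dense_imp_prod_transitive:
  fixes t :: "'i \<Rightarrow> int \<Rightarrow> 'g"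
  assumes "finite I" and t: "\<And>i. i \<in> I \<Longrightarrow> Modules.additive (t i)"
    and z: "z \<in> topspace (product_topology (\<lambda>_. X) I)"
    and dense: "product_topology (\<lambda>_. X) I closure_of {(\<lambda>i\<in>I. act (t i n) (z i)) | n. True} =
      topspace (product_topology (\<lambda>_. X) I)"
  shows "prod_transitive I (\<lambda>_. X) t"
  unfolding prod_transitive_def
proof (intro allI impI)
  fix U V assume UV: "\<forall>i\<in>I. openin X (U i) \<and> U i \<noteq> {} \<and> openin X (V i) \<and> V i \<noteq> {}"
  note visit = dense[unfolded power_orbit_dense_iff[OF assms(1) z], rule_format]
  obtain a where a: "\<And>i. i \<in> I \<Longrightarrow> act (t i a) (z i) \<in> U i" using visit[of U] UV by blast
  obtain b where b: "\<And>i. i \<in> I \<Longrightarrow> act (t i b) (z i) \<in> V i" using visit[of V] UV by blast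
  have "act (t i (b - a)) (act (t i a) (z i)) \<in> V i" if "i \<in> I" for i
  proof -
    interpret Modules.additive "t i" by (rule t[OF that])
    have "z i \<in> topspace X" using z that by (auto simp: PiE_iff)
    then show ?thesis using b[OF that] by (simp add: act_add[symmetric] diff)
  qed
  then show "\<exists>n. \<forall>i\<in>I. \<exists>u\<in>U i. act (t i n) u \<in> V i" using a by blast
qed

end

text \<open>The base consists of balls around finite nets of mesh 1/(n+1). A mesh below r/2 puts the
  ball around a nearby centre inside the ball of radius r.\<close>

lemma compact_metric_imp_second_countable:
  assumes "compact_space (mtopology_of M)"
  shows "second_countable (mtopology_of M)"
proof -
  interpret Metric_space "mspace M" "mdist M" by simp
  have eq: "mtopology_of M = mtopology" by (simp add: mtopology_of_def)
  have "\<exists>F. finite F \<and> F \<subseteq> mspace M \<and> mspace M \<subseteq> (\<Union>x\<in>F. mball x (1 / real (Suc n)))" for n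
  proof -
    have "mtotally_bounded (mspace M)"
      using compactin_imp_mtotally_bounded[of "mspace M"] assms unfolding eq compact_space_def by simp
    then show ?thesis unfolding mtotally_bounded_def by (metis of_nat_0_less_iff zero_less_Suc zero_less_divide_1_iff)
  qed
  then obtain F where F: "\<And>n. finite (F n)" "\<And>n. F n \<subseteq> mspace M"
    "\<And>n. mspace M \<subseteq> (\<Union>x\<in>F n. mball x (1 / real (Suc n)))" by metis
  let ?\<B> = "\<Union>n. (\<lambda>x. mball x (1 / real (Suc n))) ` F n"
  have "\<exists>V\<in>?\<B>. x \<in> V \<and> V \<subseteq> U" if U: "openin mtopology U" "x \<in> U" for U x
  proof -
    obtain r where r: "r > 0" "mball x r \<subseteq> U" using U unfolding openin_mtopology by blast
    have xM: "x \<in> mspace M" using U unfolding openin_mtopology by blast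
    obtain n where n: "1 / real (Suc n) < r / 2" using r(1) nat_approx_posE[of "r/2"] by auto
    obtain y where y: "y \<in> F n" "x \<in> mball y (1 / real (Suc n))" using F(3)[of n] xM by blast
    have "mball y (1 / real (Suc n)) \<subseteq> mball x r"
    proof
      fix z assume z: "z \<in> mball y (1 / real (Suc n))"
      have "mdist M x z \<le> mdist M x y + mdist M y z" using y(2) z by (intro triangle) auto
      then show "z \<in> mball x r" using y(2) z n commute[of x y] by (auto simp: in_mball)
    qed
    then show ?thesis using y r(2) by blast
  qed
  then show ?thesis
    unfolding second_countable_def eq using F(1)
    by (intro exI[of _ ?\<B>]) (auto simp: countable_finite)
qed

section \<open>Actions of integer lattices\<close>

text \<open>A homomorphism from the integers is determined by its value at 1. This evaluates the
  powers of the T_i, of their quotients and of the product map.\<close>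

lemma (in group) int_pow_hom_eq:
  assumes "\<And>n. f n \<in> carrier G" "\<And>m n. f (m + n) = f m \<otimes> f n"
  shows "f 1 [^] (n::int) = f n"
proof -
  have "f 0 \<otimes> f 0 = f 0" using assms(2)[of 0 0] by simp
  then have zero: "f 0 = \<one>" using assms(1)[of 0] by (simp add: r_cancel_one)
  show ?thesis
  proof (induction n rule: int_induct[of _ 0])
    case base
    then show ?case using zero by simp
  next
    case (step1 n)
    then show ?case using assms by (simp add: int_pow_mult)
  next
    case (step2 n)
    have "f n = f (n - 1) \<otimes> f 1" using assms(2)[of "n - 1" 1] by simp
    then have "f (n - 1) = f n \<otimes> inv f 1" using assms(1) by (simp add: inv_solve_right)
    then show ?case using step2 assms(1) by (simp add: int_pow_diff)
  qed
qed

text \<open>Expresses commutation as membership in a subgroup, so that it extends from generators to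
  powers and words by closure.\<close>

lemma (in group) subgroup_centralizer:
  assumes "y \<in> carrier G" shows "subgroup {x \<in> carrier G. x \<otimes> y = y \<otimes> x} G"
proof (rule subgroup.intro)
  fix a b assume a: "a \<in> {x \<in> carrier G. x \<otimes> y = y \<otimes> x}" and b: "b \<in> {x \<in> carrier G. x \<otimes> y = y \<otimes> x}"
  have "a \<otimes> b \<otimes> y = a \<otimes> (y \<otimes> b)" using a b assms by (simp add: m_assoc)
  also have "\<dots> = y \<otimes> (a \<otimes> b)" using a b assms by (simp flip: m_assoc)
  finally show "a \<otimes> b \<in> {x \<in> carrier G. x \<otimes> y = y \<otimes> x}" using a b by simp
next
  fix a assume a: "a \<in> {x \<in> carrier G. x \<otimes> y = y \<otimes> x}"
  then have aC: "a \<in> carrier G" by simp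
  have "inv a \<otimes> y \<otimes> a = inv a \<otimes> (a \<otimes> y)" using a assms by (simp add: m_assoc)
  also have "\<dots> = y" using aC assms by (simp flip: m_assoc)
  finally show "inv a \<in> {x \<in> carrier G. x \<otimes> y = y \<otimes> x}"
    using a assms by (simp add: inv_solve_right)
qed (use assms in auto)

section \<open>The maps S_1^{m_1} ... S_k^{m_k} in the group of bijections\<close>

lemma bij_grp_carrier: "carrier (bij_grp X) = Bij (topspace X)"
  by (simp add: BijGroup_def)

lemma bij_grp_mult_apply:
  "\<lbrakk>f \<in> Bij (topspace X); g \<in> Bij (topspace X); x \<in> topspace X\<rbrakk> \<Longrightarrow> (f \<otimes>\<^bsub>bij_grp X\<^esub> g) x = f (g x)"
  by (simp add: BijGroup_def compose_def)

lemma bij_grp_one_apply: "x \<in> topspace X \<Longrightarrow> \<one>\<^bsub>bij_grp X\<^esub> x = x"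
  by (simp add: BijGroup_def)

lemma Bij_closed: "\<lbrakk>f \<in> Bij S; x \<in> S\<rbrakk> \<Longrightarrow> f x \<in> S"
  using Bij_imp_funcset by blast

lemma bij_grp_mult_eqI:
  assumes "f \<in> Bij (topspace X)" "g \<in> Bij (topspace X)" "h \<in> Bij (topspace X)"
    and "\<And>x. x \<in> topspace X \<Longrightarrow> h x = f (g x)"
  shows "h = f \<otimes>\<^bsub>bij_grp X\<^esub> g"
proof (rule extensionalityI[where A = "topspace X"])
  show "h \<in> extensional (topspace X)" using assms(3) by (rule Bij_imp_extensional)
  have "f \<otimes>\<^bsub>bij_grp X\<^esub> g \<in> Bij (topspace X)"
    using assms(1,2) by (simp add: BijGroup_def compose_Bij)
  then show "f \<otimes>\<^bsub>bij_grp X\<^esub> g \<in> extensional (topspace X)" by (rule Bij_imp_extensional)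
qed (use assms in \<open>simp add: bij_grp_mult_apply\<close>)

lemma subgroup_self_homeos: "subgroup (self_homeos X) (bij_grp X)"
proof (rule subgroup.intro)
  show "self_homeos X \<subseteq> carrier (bij_grp X)" by (auto simp: self_homeos_def bij_grp_carrier)
  show "\<one>\<^bsub>bij_grp X\<^esub> \<in> self_homeos X"
    using homeomorphic_map_eq[of X X id "\<lambda>x\<in>topspace X. x"]
    by (simp add: self_homeos_def BijGroup_def id_Bij homeomorphic_map_id)
next
  fix f g assume "f \<in> self_homeos X" "g \<in> self_homeos X"
  then have f: "f \<in> Bij (topspace X)" "homeomorphic_map X X f"
    and g: "g \<in> Bij (topspace X)" "homeomorphic_map X X g" by (auto simp: self_homeos_def)
  have "homeomorphic_map X X (compose (topspace X) f g)"
    by (rule homeomorphic_map_eq[OF homeomorphic_map_compose[OF g(2) f(2)]]) (simp add: compose_def)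
  then show "f \<otimes>\<^bsub>bij_grp X\<^esub> g \<in> self_homeos X"
    using f(1) g(1) by (simp add: self_homeos_def BijGroup_def compose_Bij)
next
  fix f assume "f \<in> self_homeos X"
  then have f: "f \<in> Bij (topspace X)" "homeomorphic_map X X f" by (auto simp: self_homeos_def)
  then obtain g where g: "homeomorphic_maps X X f g" using homeomorphic_map_maps by blast
  then have "homeomorphic_map X X g" using homeomorphic_map_maps homeomorphic_maps_sym by blast
  moreover have "g x = (\<lambda>x\<in>topspace X. inv_into (topspace X) f x) x" if x: "x \<in> topspace X" for x
  proof -
    have "f (g x) = x" "g x \<in> topspace X"
      using g x by (auto simp: homeomorphic_maps_def continuous_map_def)
    moreover have "inj_on f (topspace X)" using f(1) by (simp add: Bij_def bij_betw_def)
    ultimately show ?thesis using x inv_into_f_f by fastforce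
  qed
  ultimately have "homeomorphic_map X X (\<lambda>x\<in>topspace X. inv_into (topspace X) f x)"
    by (rule homeomorphic_map_eq)
  then show "inv\<^bsub>bij_grp X\<^esub> f \<in> self_homeos X"
    using f(1) by (simp add: inv_BijGroup self_homeos_def restrict_inv_into_Bij)
qed

text \<open>Carries invariance of the mean from the generators to all \<open>zk g\<close>. For an
  inverse, invariance under f is applied to the preimage set in question.\<close>

lemma subgroup_mean_preserving:
  "subgroup {f \<in> Bij (topspace X). \<forall>A. A \<subseteq> topspace X \<longrightarrow> \<mu> {x \<in> topspace X. f x \<in> A} = \<mu> A} (bij_grp X)"
  (is "subgroup ?K _")
proof (rule subgroup.intro)
  interpret group "bij_grp X" by (rule group_BijGroup)
  show "?K \<subseteq> carrier (bij_grp X)" by (auto simp: bij_grp_carrier)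
  have "{x \<in> topspace X. \<one>\<^bsub>bij_grp X\<^esub> x \<in> A} = A" if "A \<subseteq> topspace X" for A
    using that by (auto simp: bij_grp_one_apply)
  then show "\<one>\<^bsub>bij_grp X\<^esub> \<in> ?K" using one_closed by (simp add: bij_grp_carrier)
  fix f assume f: "f \<in> ?K"
  then have fB: "f \<in> Bij (topspace X)"
    and f\<mu>: "\<And>A. A \<subseteq> topspace X \<Longrightarrow> \<mu> {x \<in> topspace X. f x \<in> A} = \<mu> A" by simp_all
  {
    fix g assume g: "g \<in> ?K"
    then have gB: "g \<in> Bij (topspace X)"
      and g\<mu>: "\<And>A. A \<subseteq> topspace X \<Longrightarrow> \<mu> {x \<in> topspace X. g x \<in> A} = \<mu> A" by simp_all
    have "\<mu> {x \<in> topspace X. (f \<otimes>\<^bsub>bij_grp X\<^esub> g) x \<in> A} = \<mu> A" if A: "A \<subseteq> topspace X" for A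
    proof -
      have "{x \<in> topspace X. (f \<otimes>\<^bsub>bij_grp X\<^esub> g) x \<in> A} =
          {x \<in> topspace X. g x \<in> {y \<in> topspace X. f y \<in> A}}"
        by (auto simp: bij_grp_mult_apply[OF fB gB] Bij_closed[OF gB])
      moreover have "\<mu> {x \<in> topspace X. g x \<in> {y \<in> topspace X. f y \<in> A}} = \<mu> {y \<in> topspace X. f y \<in> A}"
        by (rule g\<mu>) blast
      moreover have "\<mu> {y \<in> topspace X. f y \<in> A} = \<mu> A" by (rule f\<mu>[OF A])
      ultimately show ?thesis by metis
    qed
    then show "f \<otimes>\<^bsub>bij_grp X\<^esub> g \<in> ?K"
      using m_closed[of f g] fB gB by (simp only: bij_grp_carrier mem_Collect_eq) blast
  }
  let ?h = "inv\<^bsub>bij_grp X\<^esub> f"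
  have h: "?h \<in> Bij (topspace X)" using inv_closed[of f] fB by (simp add: bij_grp_carrier)
  have hf: "?h (f x) = x" if "x \<in> topspace X" for x
    using bij_grp_mult_apply[OF h fB that] l_inv[of f] fB that
    by (simp add: bij_grp_carrier bij_grp_one_apply)
  have "\<mu> {x \<in> topspace X. ?h x \<in> A} = \<mu> A" if A: "A \<subseteq> topspace X" for A
  proof -
    have "\<mu> {x \<in> topspace X. ?h x \<in> A} = \<mu> {x \<in> topspace X. f x \<in> {x \<in> topspace X. ?h x \<in> A}}"
      by (rule f\<mu>[symmetric]) blast
    also have "{x \<in> topspace X. f x \<in> {x \<in> topspace X. ?h x \<in> A}} = A"
      using A hf Bij_closed[OF fB] by auto
    finally show ?thesis .
  qed
  then show "?h \<in> ?K" using h by simp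
qed

text \<open>Serves for all bijections, for self-homeomorphisms, for mean-preserving bijections and
  for centralizers.\<close>

lemma zk_action_in_subgroup:
  assumes "subgroup K (bij_grp X)" "\<And>i. i \<in> {1..k} \<Longrightarrow> S i \<in> K"
  shows "zk_action X S m k \<in> K"
  using assms(2)
proof (induction k)
  case 0
  then show ?case using subgroup.one_closed[OF assms(1)] by simp
next
  case (Suc k)
  then show ?case
    using subgroup.m_closed[OF assms(1)] group.subgroup_int_pow_closed[OF group_BijGroup assms(1)]
    by simp
qed

lemma zk_action_Bij:
  "(\<And>i. i \<in> {1..k} \<Longrightarrow> S i \<in> Bij (topspace X)) \<Longrightarrow> zk_action X S m k \<in> Bij (topspace X)"
  by (rule zk_action_in_subgroup[of "Bij (topspace X)"])
    (use group.subgroup_self[OF group_BijGroup, of "topspace X"] in \<open>simp add: bij_grp_carrier\<close>)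

text \<open>Indices outside 1..k are included because the induction step at \<open>i = Suc k\<close>
  needs the product of the earlier factors to be the identity.\<close>

lemma zk_action_unit:
  assumes "\<And>i. i \<in> {1..k} \<Longrightarrow> S i \<in> Bij (topspace X)"
  shows "zk_action X S (\<lambda>j. if j = i then 1 else 0) k = (if i \<in> {1..k} then S i else \<one>\<^bsub>bij_grp X\<^esub>)"
  using assms
proof (induction k)
  case (Suc k)
  interpret group "bij_grp X" by (rule group_BijGroup)
  have "S (Suc k) \<in> carrier (bij_grp X)" "\<And>i. i \<in> {1..k} \<Longrightarrow> S i \<in> carrier (bij_grp X)"
    using Suc.prems by (auto simp: bij_grp_carrier)
  then show ?case using Suc by auto
qed simp

lemma zk_action_add:
  assumes "\<And>i. i \<in> {1..k} \<Longrightarrow> S i \<in> Bij (topspace X)"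
    and "\<And>i j. \<lbrakk>i \<in> {1..k}; j \<in> {1..k}\<rbrakk> \<Longrightarrow> S i \<otimes>\<^bsub>bij_grp X\<^esub> S j = S j \<otimes>\<^bsub>bij_grp X\<^esub> S i"
  shows "zk_action X S (m + m') k = zk_action X S m k \<otimes>\<^bsub>bij_grp X\<^esub> zk_action X S m' k"
  using assms
proof (induction k)
  case 0
  interpret group "bij_grp X" by (rule group_BijGroup)
  show ?case by simp
next
  case (Suc k)
  interpret group "bij_grp X" by (rule group_BijGroup)
  have S: "S i \<in> carrier (bij_grp X)" if "i \<in> {1..Suc k}" for i
    using Suc.prems(1)[OF that] by (simp add: bij_grp_carrier)
  let ?a = "S (Suc k) [^]\<^bsub>bij_grp X\<^esub> m (Suc k)" and ?b = "S (Suc k) [^]\<^bsub>bij_grp X\<^esub> m' (Suc k)"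
  let ?z = "zk_action X S m k" and ?w = "zk_action X S m' k"
  have z: "?z \<in> carrier (bij_grp X)" and w: "?w \<in> carrier (bij_grp X)"
    using S by (intro zk_action_in_subgroup[OF subgroup_self]; simp)+
  have a: "?a \<in> carrier (bij_grp X)" and b: "?b \<in> carrier (bij_grp X)"
    using S by auto
  have "S i \<otimes>\<^bsub>bij_grp X\<^esub> ?a = ?a \<otimes>\<^bsub>bij_grp X\<^esub> S i" if i: "i \<in> {1..k}" for i
  proof -
    have iS: "S i \<in> carrier (bij_grp X)" using S i by simp
    have "S (Suc k) \<in> {x \<in> carrier (bij_grp X). x \<otimes>\<^bsub>bij_grp X\<^esub> S i = S i \<otimes>\<^bsub>bij_grp X\<^esub> x}"
      using S Suc.prems(2)[of "Suc k" i] i by simp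
    from subgroup_int_pow_closed[OF subgroup_centralizer[OF iS] this, of "m (Suc k)"]
    show ?thesis by simp
  qed
  \<comment> \<open>The letters of \<open>?w\<close> commute with the power \<open>?a\<close>, so
    the whole word lies in its centralizer; this exchanges the two middle factors below.\<close>
  then have "?w \<in> {x \<in> carrier (bij_grp X). x \<otimes>\<^bsub>bij_grp X\<^esub> ?a = ?a \<otimes>\<^bsub>bij_grp X\<^esub> x}"
    using S by (intro zk_action_in_subgroup[OF subgroup_centralizer[OF a]]) simp
  then have wa: "?w \<otimes>\<^bsub>bij_grp X\<^esub> ?a = ?a \<otimes>\<^bsub>bij_grp X\<^esub> ?w" by simp
  have IH: "zk_action X S (m + m') k = ?z \<otimes>\<^bsub>bij_grp X\<^esub> ?w"
    using Suc.prems by (intro Suc.IH) simp_all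
  have "zk_action X S (m + m') (Suc k) = (?z \<otimes>\<^bsub>bij_grp X\<^esub> ?w) \<otimes>\<^bsub>bij_grp X\<^esub> (?a \<otimes>\<^bsub>bij_grp X\<^esub> ?b)"
    using S by (simp add: IH int_pow_mult)
  also have "\<dots> = ?z \<otimes>\<^bsub>bij_grp X\<^esub> ((?w \<otimes>\<^bsub>bij_grp X\<^esub> ?a) \<otimes>\<^bsub>bij_grp X\<^esub> ?b)"
    using z w a b by (simp add: m_assoc)
  also have "\<dots> = (?z \<otimes>\<^bsub>bij_grp X\<^esub> ?a) \<otimes>\<^bsub>bij_grp X\<^esub> (?w \<otimes>\<^bsub>bij_grp X\<^esub> ?b)"
    using z w a b by (simp add: wa m_assoc)
  finally show ?case by (simp only: zk_action.simps)
qed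

locale commuting_homeos =
  fixes X :: "'a topology" and k :: nat and S :: "nat \<Rightarrow> 'a \<Rightarrow> 'a"
  assumes homeos: "i \<in> {1..k} \<Longrightarrow> S i \<in> self_homeos X"
    and commute: "\<lbrakk>i \<in> {1..k}; j \<in> {1..k}; x \<in> topspace X\<rbrakk> \<Longrightarrow> S i (S j x) = S j (S i x)"
begin

sublocale group "bij_grp X" by (rule group_BijGroup)

abbreviation zk :: "(nat \<Rightarrow> int) \<Rightarrow> 'a \<Rightarrow> 'a"
  where "zk m \<equiv> zk_action X S m k"

lemma generator_Bij: "i \<in> {1..k} \<Longrightarrow> S i \<in> Bij (topspace X)"
  using homeos by (simp add: self_homeos_def)

lemma zk_Bij: "zk m \<in> Bij (topspace X)"
  using generator_Bij by (rule zk_action_Bij)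

lemma zk_carrier: "zk m \<in> carrier (bij_grp X)"
  by (simp add: bij_grp_carrier zk_Bij)

lemma zk_add: "zk (m + m') = zk m \<otimes>\<^bsub>bij_grp X\<^esub> zk m'"
proof (rule zk_action_add[OF generator_Bij])
  fix i j assume ij: "i \<in> {1..k}" "j \<in> {1..k}"
  have "S i \<otimes>\<^bsub>bij_grp X\<^esub> S j \<in> Bij (topspace X)"
    using generator_Bij ij m_closed by (simp add: bij_grp_carrier)
  then show "S i \<otimes>\<^bsub>bij_grp X\<^esub> S j = S j \<otimes>\<^bsub>bij_grp X\<^esub> S i"
    using generator_Bij ij commute by (intro bij_grp_mult_eqI) (simp_all add: bij_grp_mult_apply)
qed

lemma zk_zero: "zk 0 = \<one>\<^bsub>bij_grp X\<^esub>"
  using zk_add[of 0 0] zk_carrier by (simp add: r_cancel_one')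

lemma zk_uminus: "zk (- m) = inv\<^bsub>bij_grp X\<^esub> (zk m)"
  using zk_add[of "- m" m] zk_carrier by (intro inv_equality[symmetric]) (simp_all add: zk_zero)

lemma generate_subset_range_zk: "generate (bij_grp X) (S ` {1..k}) \<subseteq> range zk"
proof (rule generate_subgroup_incl)
  show "S ` {1..k} \<subseteq> range zk"
  proof clarify
    fix i assume "i \<in> {1..k}"
    then have "S i = zk (\<lambda>j. if j = i then 1 else 0)" using zk_action_unit[OF generator_Bij] by simp
    then show "S i \<in> range zk" by blast
  qed
  show "subgroup (range zk) (bij_grp X)"
    using zk_carrier by (intro subgroup.intro) (auto simp flip: zk_add zk_uminus zk_zero)
qed

lemma zk_int_pow: "zk m [^]\<^bsub>bij_grp X\<^esub> (n::int) = zk (\<lambda>l. n * m l)"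
proof -
  have "zk (\<lambda>l. (a + b) * m l) = zk (\<lambda>l. a * m l) \<otimes>\<^bsub>bij_grp X\<^esub> zk (\<lambda>l. b * m l)" for a b
    using zk_add[of "\<lambda>l. a * m l" "\<lambda>l. b * m l"] by (simp add: plus_fun_def algebra_simps)
  from int_pow_hom_eq[of "\<lambda>n. zk (\<lambda>l. n * m l)", OF zk_carrier this]
  show ?thesis by simp
qed

end

section \<open>From a minimal system to an action with an invariant mean\<close>

lemma minimal_zk_system_imp_action:
  fixes M :: "'a metric"
  defines "X \<equiv> mtopology_of M"
  assumes "minimal_zk_system M k S"
  shows "commuting_homeos X k S" "\<exists>\<mu>. minimal_action_mean X (\<lambda>m. zk_action X S m k) \<mu>"
proof -
  have sys: "mspace M \<noteq> {}" "compact_space X" "\<And>i. i \<in> {1..k} \<Longrightarrow> S i \<in> self_homeos X"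
    "\<And>i j x. \<lbrakk>i \<in> {1..k}; j \<in> {1..k}; x \<in> mspace M\<rbrakk> \<Longrightarrow> S i (S j x) = S j (S i x)"
    and minimal: "\<And>x. x \<in> mspace M \<Longrightarrow> X closure_of zk_orbit X k S x = mspace M"
    using assms(2) unfolding minimal_zk_system_def zk_system_def X_def by auto
  have top: "topspace X = mspace M" by (simp add: X_def)
  show "commuting_homeos X k S" using sys by unfold_locales (simp_all add: top)
  then interpret commuting_homeos X k S .
  \<comment> \<open>The averaging theorem is applied to the finite set of generators; invariance
    under the whole action follows at the end through a subgroup.\<close>
  have "\<exists>\<mu>. mean_on (topspace X) \<mu> \<and> (\<forall>f\<in>S ` {1..k}. \<forall>A. A \<subseteq> topspace X \<longrightarrow>
      \<mu> {x \<in> topspace X. f x \<in> A} = \<mu> A)"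
    using sys(1) Bij_closed[OF generator_Bij] commute
    by (intro commuting_maps_invariant_mean) (auto simp: top)
  then obtain \<mu> where \<mu>: "mean_on (topspace X) \<mu>" "\<And>i A. \<lbrakk>i \<in> {1..k}; A \<subseteq> topspace X\<rbrakk> \<Longrightarrow>
      \<mu> {x \<in> topspace X. S i x \<in> A} = \<mu> A" by blast
  interpret act: minimal_abelian_action X "\<lambda>m. zk m"
  proof
    show "compact_space X" by (rule sys(2))
    show "Hausdorff_space X" unfolding X_def by (simp add: mtopology_of_def Metric_space.Hausdorff_space_mtopology)
    show "continuous_map X X (zk m)" for m
    proof -
      have "zk m \<in> self_homeos X" by (rule zk_action_in_subgroup[OF subgroup_self_homeos homeos])
      then show ?thesis by (simp add: self_homeos_def homeomorphic_imp_continuous_map)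
    qed
    show "zk 0 x = x" if "x \<in> topspace X" for x using that by (simp add: zk_zero bij_grp_one_apply)
    show "zk (m + m') x = zk m (zk m' x)" if "x \<in> topspace X" for m m' x
      using that by (simp add: zk_add bij_grp_mult_apply zk_Bij)
    show "X closure_of range (\<lambda>m. zk m x) = topspace X" if "x \<in> topspace X" for x
    proof -
      have "zk_orbit X k S x = range (\<lambda>m. zk m x)" by (auto simp: zk_orbit_def)
      then show ?thesis using minimal[of x] that by (simp add: top)
    qed
  qed
  have "minimal_action_mean X (\<lambda>m. zk m) \<mu>"
  proof
    show "mean_on (topspace X) \<mu>" by (rule \<mu>(1))
    fix A g assume A: "A \<subseteq> topspace X"
    have "zk g \<in> {f \<in> Bij (topspace X). \<forall>A. A \<subseteq> topspace X \<longrightarrow>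
        \<mu> {x \<in> topspace X. f x \<in> A} = \<mu> A}"
      using generator_Bij \<mu>(2) by (intro zk_action_in_subgroup[OF subgroup_mean_preserving]) simp
    then show "\<mu> (act.pre g A) = \<mu> A" using A by (simp add: act.pre_def)
  qed
  then show "\<exists>\<mu>. minimal_action_mean X (\<lambda>m. zk_action X S m k) \<mu>" by blast
qed

text \<open>The product maps built from the \<open>f i n\<close> form a homomorphism from the
  integers to the bijections of the power space, with -n supplying the inverse at n, so
  \<open>int_pow_hom_eq\<close> applies.\<close>

lemma prod_map_int_pow:
  assumes "\<And>i n. f i n \<in> Bij (topspace X)"
    and "\<And>i m n. f i (m + n) = f i m \<otimes>\<^bsub>bij_grp X\<^esub> f i n"
    and "\<And>i. i \<in> {1..d} \<Longrightarrow> T i = f i 1"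
  shows "prod_map X d T [^]\<^bsub>bij_grp (power_space X d)\<^esub> (n::int) = prod_map X d (\<lambda>i. f i n)"
proof -
  let ?P = "power_space X d" and ?F = "\<lambda>n. prod_map X d (\<lambda>i. f i n)"
  have closed: "?F n x \<in> topspace ?P" if "x \<in> topspace ?P" for n x
    using that Bij_closed[OF assms(1)] by (auto simp: prod_map_def PiE_iff)
  have comp: "?F (m + n) x = ?F m (?F n x)" if "x \<in> topspace ?P" for m n x
    using that closed[OF that, of n] bij_grp_mult_apply[OF assms(1,1)]
    by (auto simp: prod_map_def PiE_iff assms(2) intro!: restrict_ext)
  have "f i 0 x = x" if "x \<in> topspace X" for i x
  proof -
    interpret group "bij_grp X" by (rule group_BijGroup)
    have "f i 0 = \<one>\<^bsub>bij_grp X\<^esub>"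
      using assms(2)[of i 0 0] assms(1) by (simp add: r_cancel_one' bij_grp_carrier)
    then show ?thesis using that by (simp add: bij_grp_one_apply)
  qed
  then have zero: "?F 0 x = x" if "x \<in> topspace ?P" for x
    using that by (auto simp: prod_map_def PiE_iff extensional_def)
  have F: "?F n \<in> Bij (topspace ?P)" for n
  proof -
    have "bij_betw (?F n) (topspace ?P) (topspace ?P)"
    proof (rule bij_betw_byWitness[where f' = "?F (- n)"]; intro ballI image_subsetI)
      fix x assume x: "x \<in> topspace ?P"
      show "?F (- n) (?F n x) = x" "?F n (?F (- n) x) = x"
        using comp[OF x, of "- n" n] comp[OF x, of n "- n"] zero[OF x] by simp_all
      show "?F n x \<in> topspace ?P" "?F (- n) x \<in> topspace ?P" using closed[OF x] by blast+
    qed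
    moreover have "?F n \<in> extensional (topspace ?P)" by (simp add: prod_map_def)
    ultimately show ?thesis by (simp add: Bij_def)
  qed
  interpret group "bij_grp ?P" by (rule group_BijGroup)
  have "?F 1 [^]\<^bsub>bij_grp ?P\<^esub> n = ?F n"
  proof (rule int_pow_hom_eq)
    show "?F n \<in> carrier (bij_grp ?P)" for n using F by (simp only: bij_grp_carrier)
    show "?F (m + n) = ?F m \<otimes>\<^bsub>bij_grp ?P\<^esub> ?F n" for m n
      by (rule bij_grp_mult_eqI[OF F F F comp])
  qed
  moreover have "prod_map X d T = ?F 1"
    unfolding prod_map_def using assms(3) by (intro restrict_ext) auto
  ultimately show ?thesis by simp
qed

section \<open>The criterion for joint transitivity\<close>

theorem theorem1p6:
  fixes M :: "'a metric" and k d :: nat and S T :: "nat \<Rightarrow> 'a \<Rightarrow> 'a"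
  defines "X \<equiv> mtopology_of M"
  assumes "minimal_zk_system M k S"
    and "\<forall>i\<in>{1..d}. T i \<in> generate (bij_grp X) (S ` {1..k})"
  shows "jointly_transitive X d (\<lambda>i n. T i [^]\<^bsub>bij_grp X\<^esub> n) \<longleftrightarrow>
    (\<forall>i\<in>{1..d}. \<forall>j\<in>{1..d}. i \<noteq> j \<longrightarrow>
        transitive_homeo X (inv\<^bsub>bij_grp X\<^esub> (T i) \<otimes>\<^bsub>bij_grp X\<^esub> T j)) \<and>
    transitive_homeo (power_space X d) (prod_map X d T)"
proof -
  interpret commuting_homeos X k S
    unfolding X_def by (rule minimal_zk_system_imp_action(1)[OF assms(2)])
  obtain \<mu> where "minimal_action_mean X (\<lambda>m. zk m) \<mu>"
    using minimal_zk_system_imp_action(2)[OF assms(2)] unfolding X_def by blast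
  then interpret act: minimal_action_mean X "\<lambda>m. zk m" \<mu> .
  have nonempty: "topspace X \<noteq> {}" and second: "second_countable X"
    using assms(2) compact_metric_imp_second_countable[of M]
    unfolding minimal_zk_system_def zk_system_def X_def by auto
  have "\<forall>i\<in>{1..d}. \<exists>m. T i = zk m" using assms(3) generate_subset_range_zk by blast
  then obtain m where T: "\<And>i. i \<in> {1..d} \<Longrightarrow> T i = zk (m i)" by metis
  define t where "t i n = (\<lambda>l. n * m i l)" for i and n :: int
  have t: "Modules.additive (t i)" for i
    by unfold_locales (simp add: t_def plus_fun_def algebra_simps)
  have t_diff: "Modules.additive (\<lambda>n. t j n - t i n)" for i j
  proof -
    interpret ti: Modules.additive "t i" by (rule t)
    interpret tj: Modules.additive "t j" by (rule t)
    show ?thesis by unfold_locales (simp add: ti.add tj.add)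
  qed
  have pow: "T i [^]\<^bsub>bij_grp X\<^esub> n = zk (t i n)" if "i \<in> {1..d}" for i and n :: int
    unfolding T[OF that] t_def by (rule zk_int_pow)
  let ?I = "{1..d}" and ?P = "power_space X d"
  have quotient: "transitive_homeo X (inv\<^bsub>bij_grp X\<^esub> (T i) \<otimes>\<^bsub>bij_grp X\<^esub> T j) \<longleftrightarrow>
      act.transitive (\<lambda>n. t j n - t i n)" if ij: "i \<in> ?I" "j \<in> ?I" for i j
  proof -
    interpret Modules.additive "\<lambda>n. t j n - t i n" by (rule t_diff)
    have "inv\<^bsub>bij_grp X\<^esub> (T i) \<otimes>\<^bsub>bij_grp X\<^esub> T j = zk (- m i + m j)"
      by (simp only: zk_add zk_uminus T ij)
    also have "- m i + m j = t j 1 - t i 1" by (simp add: t_def fun_eq_iff)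
    finally have "(inv\<^bsub>bij_grp X\<^esub> (T i) \<otimes>\<^bsub>bij_grp X\<^esub> T j) [^]\<^bsub>bij_grp X\<^esub> n = zk (t j n - t i n)" for n :: int
      using int_pow_hom_eq[of "\<lambda>n. zk (t j n - t i n)" n] zk_carrier by (simp only: add zk_add)
    then show ?thesis
      unfolding transitive_homeo_def act.transitive_iff_dense_orbit[OF second nonempty t_diff] by simp
  qed
  have power: "(prod_map X d T [^]\<^bsub>bij_grp ?P\<^esub> n) z = (\<lambda>i\<in>?I. zk (t i n) (z i))"
    if "z \<in> topspace ?P" for z and n :: int
  proof -
    have "zk (t i (a + b)) = zk (t i a) \<otimes>\<^bsub>bij_grp X\<^esub> zk (t i b)" for i a b
    proof -
      interpret Modules.additive "t i" by (rule t)
      show ?thesis by (simp add: add zk_add)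
    qed
    then have "prod_map X d T [^]\<^bsub>bij_grp ?P\<^esub> n = prod_map X d (\<lambda>i. zk (t i n))"
      using T by (intro prod_map_int_pow[where f = "\<lambda>i n. zk (t i n)"] zk_Bij) (simp_all add: t_def)
    then show ?thesis using that by (simp add: prod_map_def)
  qed
  \<comment> \<open>Rewrites the orbit of x under all T_i as an orbit of the diagonal point, the
    shape that \<open>power_orbit_dense_iff\<close> expects.\<close>
  have orbit: "{(\<lambda>i\<in>?I. (T i [^]\<^bsub>bij_grp X\<^esub> n) x) | n::int. True} =
      {(\<lambda>i\<in>?I. zk (t i n) ((\<lambda>i\<in>?I. x) i)) | n. True}" for x
  proof -
    have "(\<lambda>i\<in>?I. (T i [^]\<^bsub>bij_grp X\<^esub> n) x) = (\<lambda>i\<in>?I. zk (t i n) ((\<lambda>i\<in>?I. x) i))" for n :: int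
      by (rule restrict_ext) (simp add: pow)
    then show ?thesis by simp
  qed
  show ?thesis
  proof
    assume "jointly_transitive X d (\<lambda>i n. T i [^]\<^bsub>bij_grp X\<^esub> n)"
    then obtain X0 where X0: "gdelta_in X X0" "X closure_of X0 = topspace X"
      "\<And>x. x \<in> X0 \<Longrightarrow> ?P closure_of {(\<lambda>i\<in>?I. zk (t i n) ((\<lambda>i\<in>?I. x) i)) | n. True} = topspace ?P"
      unfolding jointly_transitive_def orbit by blast
    obtain x where x: "x \<in> X0" using X0(2) nonempty by fastforce
    have xX: "x \<in> topspace X" using x X0(1) by (auto simp: gdelta_in_alt)
    then have diag: "(\<lambda>i\<in>?I. x) \<in> topspace ?P" by auto
    note visit = X0(3)[OF x, unfolded act.power_orbit_dense_iff[OF finite_atLeastAtMost diag], rule_format]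
    have "transitive_homeo ?P (prod_map X d T)"
      unfolding transitive_homeo_def using X0(3)[OF x] diag
      by (intro bexI[of _ "\<lambda>i\<in>?I. x"]) (simp_all only: power[OF diag])
    moreover have "act.transitive (\<lambda>n. t j n - t i n)" if ij: "i \<in> ?I" "j \<in> ?I" "i \<noteq> j" for i j
      unfolding act.transitive_def
    proof (intro allI impI)
      fix U V assume UV: "openin X U \<and> U \<noteq> {} \<and> openin X V \<and> V \<noteq> {}"
      \<comment> \<open>U is placed in coordinate i and V in all others. At the time found, the
        quotient of T_j by T_i carries the visit to U onto the visit to V.\<close>
      have "\<exists>n. \<forall>l\<in>?I. zk (t l n) ((\<lambda>i\<in>?I. x) l) \<in> (if l = i then U else V)"
        by (rule visit) (use UV in simp)
      then obtain n where n: "\<And>l. l \<in> ?I \<Longrightarrow> zk (t l n) ((\<lambda>i\<in>?I. x) l) \<in> (if l = i then U else V)"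
        by blast
      have "zk (t i n) x \<in> U" "zk (t j n) x \<in> V" using n[of i] n[of j] ij by auto
      moreover have "zk (t j n - t i n) (zk (t i n) x) = zk (t j n) x"
        by (simp add: act.act_add[OF xX, symmetric])
      ultimately show "\<exists>n. \<exists>u\<in>U. zk (t j n - t i n) u \<in> V" by metis
    qed
    ultimately show "(\<forall>i\<in>?I. \<forall>j\<in>?I. i \<noteq> j \<longrightarrow>
        transitive_homeo X (inv\<^bsub>bij_grp X\<^esub> (T i) \<otimes>\<^bsub>bij_grp X\<^esub> T j)) \<and>
      transitive_homeo ?P (prod_map X d T)"
      using quotient by blast
  next
    assume *: "(\<forall>i\<in>?I. \<forall>j\<in>?I. i \<noteq> j \<longrightarrow>
        transitive_homeo X (inv\<^bsub>bij_grp X\<^esub> (T i) \<otimes>\<^bsub>bij_grp X\<^esub> T j)) \<and>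
      transitive_homeo ?P (prod_map X d T)"
    then obtain z where z: "z \<in> topspace ?P"
      "?P closure_of {(\<lambda>i\<in>?I. zk (t i n) (z i)) | n. True} = topspace ?P"
      unfolding transitive_homeo_def using power by auto
    \<comment> \<open>Condition (ii) enters twice through this fact: for the transitivity of each
      T_i and for Bohr density of the tuple.\<close>
    have prod: "act.prod_transitive ?I (\<lambda>_. X) t"
      by (rule act.power_orbit_dense_imp_prod_transitive[OF _ t z]) simp
    have "\<exists>x\<in>W. \<exists>n. \<forall>i\<in>?I. zk (t i n) x \<in> V i"
      if "openin X W" "W \<noteq> {}" "\<And>i. i \<in> ?I \<Longrightarrow> openin X (V i) \<and> V i \<noteq> {}" for W V
    proof (rule act.joint_visit[OF _ t])
      show "act.transitive (t i)" if "i \<in> ?I" for i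
        by (rule act.prod_transitive_imp_transitive[OF prod that])
      show "act.transitive (\<lambda>n. t j n - t i n)" if "i \<in> ?I" "j \<in> ?I" "i \<noteq> j" for i j
        using * quotient that by blast
      show "act.bohr_dense ?I t" by (rule act.prod_transitive_imp_bohr_dense[OF prod])
    qed (use that in auto)
    then have "\<exists>X0. gdelta_in X X0 \<and> X closure_of X0 = topspace X \<and> (\<forall>x\<in>X0. \<forall>V.
        (\<forall>i\<in>?I. openin X (V i) \<and> V i \<noteq> {}) \<longrightarrow> (\<exists>n. \<forall>i\<in>?I. zk (t i n) x \<in> V i))"
      by (intro act.generic_visits second) auto
    then obtain X0 where X0: "gdelta_in X X0" "X closure_of X0 = topspace X"
      "\<forall>x\<in>X0. \<forall>V. (\<forall>i\<in>?I. openin X (V i) \<and> V i \<noteq> {}) \<longrightarrow> (\<exists>n. \<forall>i\<in>?I. zk (t i n) x \<in> V i)"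
      by (elim exE conjE) (rule that)
    have "?P closure_of {(\<lambda>i\<in>?I. zk (t i n) ((\<lambda>i\<in>?I. x) i)) | n. True} = topspace ?P"
      if x: "x \<in> X0" for x
    proof -
      have "x \<in> topspace X" using x X0(1) by (auto simp: gdelta_in_alt)
      then have diag: "(\<lambda>i\<in>?I. x) \<in> topspace ?P" by auto
      show ?thesis
        unfolding act.power_orbit_dense_iff[OF finite_atLeastAtMost diag]
      proof (intro allI impI)
        fix V assume "\<forall>i\<in>?I. openin X (V i) \<and> V i \<noteq> {}"
        then obtain n where "\<forall>i\<in>?I. zk (t i n) x \<in> V i" using X0(3) x by blast
        then show "\<exists>n. \<forall>i\<in>?I. zk (t i n) ((\<lambda>i\<in>?I. x) i) \<in> V i" by (intro exI[of _ n]) simp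
      qed
    qed
    then show "jointly_transitive X d (\<lambda>i n. T i [^]\<^bsub>bij_grp X\<^esub> n)"
      unfolding jointly_transitive_def orbit using X0(1,2) by blast
  qed
qed

end
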